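(* Let $P$ be a probabilistic logic program and let $q$ be a query. Suppose that (i) $P$ is range restricted, and (ii) for every clause of $P$ and every literal in its body that is a call to a probabilistic fact, every variable occurring in that literal also occurs in a positive literal appearing earlier (to its left) in the body of the same clause. Then every answer to $q$ is a ground instantiation of $q$, and it has a well-defined probability under the distribution semantics.
   Context: A probabilistic logic program (ProbLog-style) consists of a normal logic program (definite facts and rules whose bodies may contain negated literals) together with probabilistic facts of the form $p :: a$, where $a$ is an atom, possibly containing variables, and $p \in (0,1]$; each grounding $a\theta$ is independently true with probability $p$ and false with probability $1-p$ (if $p=1$ the fact is deterministic). An atomic choice $(a,\theta,k)$ with $k\in\{0,1\}$ records whether the grounding $a\theta$ is selected ($k=1$) or not ($k=0$). A composite choice is a set of atomic choices that never contains both $(a,\theta,0)$ and $(a,\theta,1)$; its probability is $\prod_{(a_i,\theta,1)} p_i \prod_{(a_i,\theta,0)} (1-p_i)$. A total composite choice contains one atomic choice for every grounding of every probabilistic fact, and determines a world: the logic program obtained by adding the selected groundings as facts; every world is assumed to have a two-valued well-founded model. Under the distribution semantics, the probability of a ground query is the measure of the set of worlds in which it is true, computed from a countable covering set of explanations (composite choices all of whose compatible worlds entail the query), possibly infinite when function symbols are present. A program is range restricted if every variable appearing in the head of a clause also appears in a positive literal in its body. A query is a conjunction of atoms; its answers are the instantiations obtained by SLDNF resolution, where literals in clause bodies are ordered and selected left to right. *)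

theory Defs
  imports "HOL-Probability.Probability"
begin

section \<open>Syntax\<close>

text \<open>Variables are natural numbers, so that fresh variants of clauses always exist.\<close>

datatype 'f trm = Var nat | Fun 'f "'f trm list"

datatype ('f, 'p) atom = Atom 'p "'f trm list"

datatype ('f, 'p) lit = Pos "('f, 'p) atom" | Neg "('f, 'p) atom"

datatype ('f, 'p) clause = Clause (head: "('f, 'p) atom") (body: "('f, 'p) lit list")

text \<open>Probabilistic facts form a list: two syntactically equal entries are distinct,
  independent probabilistic facts. Definite facts are rules with an empty body.\<close>

datatype ('f, 'p) plp =
  PLP (rules: "('f, 'p) clause list") (pfacts: "(real \<times> ('f, 'p) atom) list")

type_synonym 'f sub = "nat \<Rightarrow> 'f trm"

fun tvars :: "'f trm \<Rightarrow> nat set" where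
  "tvars (Var x) = {x}"
| "tvars (Fun f ts) = (\<Union>t\<in>set ts. tvars t)"

fun tsubst :: "'f trm \<Rightarrow> 'f sub \<Rightarrow> 'f trm" where
  "tsubst (Var x) s = s x"
| "tsubst (Fun f ts) s = Fun f (map (\<lambda>t. tsubst t s) ts)"

fun avars :: "('f, 'p) atom \<Rightarrow> nat set" where
  "avars (Atom p ts) = (\<Union>t\<in>set ts. tvars t)"

fun asubst :: "('f, 'p) atom \<Rightarrow> 'f sub \<Rightarrow> ('f, 'p) atom" where
  "asubst (Atom p ts) s = Atom p (map (\<lambda>t. tsubst t s) ts)"

fun lit_atom :: "('f, 'p) lit \<Rightarrow> ('f, 'p) atom" where
  "lit_atom (Pos a) = a"
| "lit_atom (Neg a) = a"

definition lvars :: "('f, 'p) lit \<Rightarrow> nat set" where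
  "lvars l = avars (lit_atom l)"

fun lsubst :: "('f, 'p) lit \<Rightarrow> 'f sub \<Rightarrow> ('f, 'p) lit" where
  "lsubst (Pos a) s = Pos (asubst a s)"
| "lsubst (Neg a) s = Neg (asubst a s)"

definition cvars :: "('f, 'p) clause \<Rightarrow> nat set" where
  "cvars C = avars (head C) \<union> (\<Union>l\<in>set (body C). lvars l)"

definition csubst :: "('f, 'p) clause \<Rightarrow> 'f sub \<Rightarrow> ('f, 'p) clause" where
  "csubst C s = Clause (asubst (head C) s) (map (\<lambda>l. lsubst l s) (body C))"

definition qvars :: "('f, 'p) atom list \<Rightarrow> nat set" where
  "qvars q = (\<Union>a\<in>set q. avars a)"

definition qsubst :: "('f, 'p) atom list \<Rightarrow> 'f sub \<Rightarrow> ('f, 'p) atom list" where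
  "qsubst q s = map (\<lambda>a. asubst a s) q"

definition ground_instance :: "('f, 'p) atom list \<Rightarrow> ('f, 'p) atom list \<Rightarrow> bool" where
  "ground_instance q r \<longleftrightarrow> (\<exists>s. r = qsubst q s) \<and> qvars r = {}"

text \<open>A signature is a set of function symbols paired with arities; constants have arity 0.\<close>

fun wf_trm :: "('f \<times> nat) set \<Rightarrow> 'f trm \<Rightarrow> bool" where
  "wf_trm S (Var x) \<longleftrightarrow> True"
| "wf_trm S (Fun f ts) \<longleftrightarrow> (f, length ts) \<in> S \<and> (\<forall>t\<in>set ts. wf_trm S t)"

fun wf_atom :: "('f \<times> nat) set \<Rightarrow> ('f, 'p) atom \<Rightarrow> bool" where
  "wf_atom S (Atom p ts) \<longleftrightarrow> (\<forall>t\<in>set ts. wf_trm S t)"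

definition wf_clause :: "('f \<times> nat) set \<Rightarrow> ('f, 'p) clause \<Rightarrow> bool" where
  "wf_clause S C \<longleftrightarrow> wf_atom S (head C) \<and> (\<forall>l\<in>set (body C). wf_atom S (lit_atom l))"

definition wf_plp :: "('f \<times> nat) set \<Rightarrow> ('f, 'p) plp \<Rightarrow> bool" where
  "wf_plp S P \<longleftrightarrow> (\<forall>C\<in>set (rules P). wf_clause S C) \<and>
     (\<forall>(p, a)\<in>set (pfacts P). 0 < p \<and> p \<le> 1 \<and> wf_atom S a)"

definition herbrand_universe :: "('f \<times> nat) set \<Rightarrow> 'f trm set" where
  "herbrand_universe S = {t. wf_trm S t \<and> tvars t = {}}"

definition herbrand_base :: "('f \<times> nat) set \<Rightarrow> ('f, 'p) atom set" where
  "herbrand_base S = {a. wf_atom S a \<and> avars a = {}}"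

section \<open>Syntactic restrictions\<close>

definition pos_vars :: "('f, 'p) lit list \<Rightarrow> nat set" where
  "pos_vars ls = (\<Union>a\<in>{a. Pos a \<in> set ls}. avars a)"

definition range_restricted :: "('f, 'p) plp \<Rightarrow> bool" where
  "range_restricted P \<longleftrightarrow> (\<forall>C\<in>set (rules P). avars (head C) \<subseteq> pos_vars (body C))"

text \<open>Unifiability up to renaming apart: the two atoms may be instantiated independently.\<close>

definition unifiable_apart :: "('f, 'p) atom \<Rightarrow> ('f, 'p) atom \<Rightarrow> bool" where
  "unifiable_apart a b \<longleftrightarrow> (\<exists>s t. asubst a s = asubst b t)"

definition calls_pfact :: "('f, 'p) plp \<Rightarrow> ('f, 'p) lit \<Rightarrow> bool" where
  "calls_pfact P l \<longleftrightarrow> (\<exists>(p, a)\<in>set (pfacts P). unifiable_apart (lit_atom l) a)"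

definition pfact_calls_bound :: "('f, 'p) plp \<Rightarrow> bool" where
  "pfact_calls_bound P \<longleftrightarrow>
     (\<forall>C\<in>set (rules P). \<forall>n<length (body C). calls_pfact P (body C ! n) \<longrightarrow>
        lvars (body C ! n) \<subseteq> pos_vars (take n (body C)))"

section \<open>Composite choices and worlds\<close>

text \<open>An atomic choice refers to a probabilistic fact by its position in the program.
  The grounding substitution is a partial map whose domain is exactly the set of variables of
  the fact, so that every grounding is represented once.\<close>

type_synonym 'f achoice = "nat \<times> (nat \<rightharpoonup> 'f trm) \<times> bool"

definition groundings :: "('f \<times> nat) set \<Rightarrow> ('f, 'p) atom \<Rightarrow> (nat \<rightharpoonup> 'f trm) set" where
  "groundings S a = {th. dom th = avars a \<and> ran th \<subseteq> herbrand_universe S}"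

definition sub_of :: "(nat \<rightharpoonup> 'f trm) \<Rightarrow> 'f sub" where
  "sub_of th x = (case th x of Some t \<Rightarrow> t | None \<Rightarrow> Var x)"

definition atomic_choices :: "('f \<times> nat) set \<Rightarrow> ('f, 'p) plp \<Rightarrow> 'f achoice set" where
  "atomic_choices S P =
     {(i, th, k). i < length (pfacts P) \<and> th \<in> groundings S (snd (pfacts P ! i))}"

definition composite_choice :: "('f \<times> nat) set \<Rightarrow> ('f, 'p) plp \<Rightarrow> 'f achoice set \<Rightarrow> bool" where
  "composite_choice S P \<kappa> \<longleftrightarrow> \<kappa> \<subseteq> atomic_choices S P \<and>
     (\<forall>i th. \<not> ((i, th, False) \<in> \<kappa> \<and> (i, th, True) \<in> \<kappa>))"

definition total_choices :: "('f \<times> nat) set \<Rightarrow> ('f, 'p) plp \<Rightarrow> 'f achoice set set" where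
  "total_choices S P = {w. composite_choice S P w \<and>
     (\<forall>i<length (pfacts P). \<forall>th\<in>groundings S (snd (pfacts P ! i)). \<exists>k. (i, th, k) \<in> w)}"

definition compatible :: "('f \<times> nat) set \<Rightarrow> ('f, 'p) plp \<Rightarrow> 'f achoice set \<Rightarrow> 'f achoice set set" where
  "compatible S P \<kappa> = {w \<in> total_choices S P. \<kappa> \<subseteq> w}"

definition finite_choice_prob :: "('f, 'p) plp \<Rightarrow> 'f achoice set \<Rightarrow> real" where
  "finite_choice_prob P \<kappa> =
     (\<Prod>(i, th, k)\<in>\<kappa>. if k then fst (pfacts P ! i) else 1 - fst (pfacts P ! i))"

text \<open>For an infinite composite choice the product is the limit, i.e. the infimum, of the finite
  subproducts, all factors being in the unit interval. (The library's product over an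
  infinite set is 1.)\<close>

definition choice_prob :: "('f, 'p) plp \<Rightarrow> 'f achoice set \<Rightarrow> real" where
  "choice_prob P \<kappa> = (INF F\<in>{F. finite F \<and> F \<subseteq> \<kappa>}. finite_choice_prob P F)"

definition world_program :: "('f, 'p) plp \<Rightarrow> 'f achoice set \<Rightarrow> ('f, 'p) clause set" where
  "world_program P w = set (rules P) \<union>
     {Clause (asubst (snd (pfacts P ! i)) (sub_of th)) [] | i th. (i, th, True) \<in> w}"

section \<open>Well-founded model\<close>

text \<open>Three-valued interpretations are pairs of the set of true and the set of false atoms,
  ordered componentwise.\<close>

type_synonym ('f, 'p) interp3 = "('f, 'p) atom set \<times> ('f, 'p) atom set"

definition ground_program ::
    "('f \<times> nat) set \<Rightarrow> ('f, 'p) clause set \<Rightarrow> ('f, 'p) clause set" where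
  "ground_program S L =
     {csubst C s | C s. C \<in> L \<and> (\<forall>x\<in>cvars C. s x \<in> herbrand_universe S)}"

fun lit_true :: "('f, 'p) interp3 \<Rightarrow> ('f, 'p) lit \<Rightarrow> bool" where
  "lit_true I (Pos a) \<longleftrightarrow> a \<in> fst I"
| "lit_true I (Neg a) \<longleftrightarrow> a \<in> snd I"

fun lit_false :: "('f, 'p) interp3 \<Rightarrow> ('f, 'p) lit \<Rightarrow> bool" where
  "lit_false I (Pos a) \<longleftrightarrow> a \<in> snd I"
| "lit_false I (Neg a) \<longleftrightarrow> a \<in> fst I"

definition consequences :: "('f, 'p) clause set \<Rightarrow> ('f, 'p) interp3 \<Rightarrow> ('f, 'p) atom set" where
  "consequences G I = {head C | C. C \<in> G \<and> (\<forall>l\<in>set (body C). lit_true I l)}"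

definition unfounded_set ::
    "('f, 'p) clause set \<Rightarrow> ('f, 'p) interp3 \<Rightarrow> ('f, 'p) atom set \<Rightarrow> bool" where
  "unfounded_set G I U \<longleftrightarrow>
     (\<forall>a\<in>U. \<forall>C\<in>G. head C = a \<longrightarrow>
        (\<exists>l\<in>set (body C). lit_false I l) \<or> (\<exists>b\<in>U. Pos b \<in> set (body C)))"

definition greatest_unfounded ::
    "('f \<times> nat) set \<Rightarrow> ('f, 'p) clause set \<Rightarrow> ('f, 'p) interp3 \<Rightarrow> ('f, 'p) atom set" where
  "greatest_unfounded S G I = \<Union>{U. U \<subseteq> herbrand_base S \<and> unfounded_set G I U}"

definition wf_op ::
    "('f \<times> nat) set \<Rightarrow> ('f, 'p) clause set \<Rightarrow> ('f, 'p) interp3 \<Rightarrow> ('f, 'p) interp3" where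
  "wf_op S G I = (consequences G I, greatest_unfounded S G I)"

lemma lit_true_mono: "I \<le> J \<Longrightarrow> lit_true I l \<Longrightarrow> lit_true J l"
  by (cases l) (auto simp: less_eq_prod_def)

lemma lit_false_mono: "I \<le> J \<Longrightarrow> lit_false I l \<Longrightarrow> lit_false J l"
  by (cases l) (auto simp: less_eq_prod_def)

lemma wf_op_mono: "mono (wf_op S G)"
proof
  fix I J :: "('a, 'b) interp3"
  assume IJ: "I \<le> J"
  have "consequences G I \<subseteq> consequences G J"
    unfolding consequences_def using lit_true_mono[OF IJ] by blast
  moreover have "unfounded_set G I U \<Longrightarrow> unfounded_set G J U" for U
    unfolding unfounded_set_def using lit_false_mono[OF IJ] by blast
  then have "greatest_unfounded S G I \<subseteq> greatest_unfounded S G J"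
    unfolding greatest_unfounded_def by blast
  ultimately show "wf_op S G I \<le> wf_op S G J"
    by (simp add: wf_op_def less_eq_prod_def)
qed

definition wf_model :: "('f \<times> nat) set \<Rightarrow> ('f, 'p) clause set \<Rightarrow> ('f, 'p) interp3" where
  "wf_model S L = lfp (wf_op S (ground_program S L))"

definition two_valued_wfm :: "('f \<times> nat) set \<Rightarrow> ('f, 'p) clause set \<Rightarrow> bool" where
  "two_valued_wfm S L \<longleftrightarrow> fst (wf_model S L) \<union> snd (wf_model S L) = herbrand_base S"

section \<open>Distribution semantics\<close>

text \<open>Worlds are identified with the total composite choices determining them.\<close>

definition true_worlds ::
    "('f \<times> nat) set \<Rightarrow> ('f, 'p) plp \<Rightarrow> ('f, 'p) atom list \<Rightarrow> 'f achoice set set" where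
  "true_worlds S P g =
     {w \<in> total_choices S P. set g \<subseteq> fst (wf_model S (world_program P w))}"

definition world_measure ::
    "('f \<times> nat) set \<Rightarrow> ('f, 'p) plp \<Rightarrow> 'f achoice set measure \<Rightarrow> bool" where
  "world_measure S P M \<longleftrightarrow> prob_space M \<and> space M = total_choices S P \<and>
     sets M = sigma_sets (total_choices S P)
       {compatible S P \<kappa> | \<kappa>. finite \<kappa> \<and> composite_choice S P \<kappa>} \<and>
     (\<forall>\<kappa>. finite \<kappa> \<and> composite_choice S P \<kappa> \<longrightarrow>
        measure M (compatible S P \<kappa>) = finite_choice_prob P \<kappa>)"

definition explanation ::
    "('f \<times> nat) set \<Rightarrow> ('f, 'p) plp \<Rightarrow> ('f, 'p) atom list \<Rightarrow> 'f achoice set \<Rightarrow> bool" where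
  "explanation S P g \<kappa> \<longleftrightarrow> composite_choice S P \<kappa> \<and> compatible S P \<kappa> \<subseteq> true_worlds S P g"

definition covering ::
    "('f \<times> nat) set \<Rightarrow> ('f, 'p) plp \<Rightarrow> ('f, 'p) atom list \<Rightarrow> 'f achoice set set \<Rightarrow> bool" where
  "covering S P g K \<longleftrightarrow> true_worlds S P g \<subseteq> (\<Union>\<kappa>\<in>K. compatible S P \<kappa>)"

definition incompatible :: "'f achoice set \<Rightarrow> 'f achoice set \<Rightarrow> bool" where
  "incompatible \<kappa> \<kappa>' \<longleftrightarrow> (\<exists>i th k. (i, th, k) \<in> \<kappa> \<and> (i, th, \<not> k) \<in> \<kappa>')"

text \<open>The distribution over worlds exists and is unique, the set of worlds in which the ground
  query is true is an event, and every countable covering set of pairwise incompatible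
  explanations yields its measure. The existence of such a covering set is not part of the
  notion: with negation and function symbols a query may be true exactly when infinitely many
  groundings of a probabilistic fact are selected, and no countable set of explanations covers
  that event.\<close>

definition well_defined_prob ::
    "('f \<times> nat) set \<Rightarrow> ('f, 'p) plp \<Rightarrow> ('f, 'p) atom list \<Rightarrow> bool" where
  "well_defined_prob S P g \<longleftrightarrow> (\<exists>!M. world_measure S P M) \<and>
     (\<forall>M. world_measure S P M \<longrightarrow> true_worlds S P g \<in> sets M \<and>
        (\<forall>K. countable K \<and> (\<forall>\<kappa>\<in>K. explanation S P g \<kappa>) \<and> covering S P g K \<and>
             pairwise incompatible K \<longrightarrow>
           (choice_prob P has_sum measure M (true_worlds S P g)) K))"

section \<open>SLDNF resolution\<close>

definition is_mgu :: "'f sub \<Rightarrow> ('f, 'p) atom \<Rightarrow> ('f, 'p) atom \<Rightarrow> bool" where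
  "is_mgu s a b \<longleftrightarrow> asubst a s = asubst b s \<and>
     (\<forall>t. asubst a t = asubst b t \<longrightarrow> (\<exists>u. \<forall>x. t x = tsubst (s x) u))"

definition variant_of :: "('f, 'p) clause \<Rightarrow> ('f, 'p) clause \<Rightarrow> bool" where
  "variant_of C' C \<longleftrightarrow> (\<exists>r. bij r \<and> C' = csubst C (\<lambda>x. Var (r x)))"

definition goal_vars :: "('f, 'p) lit list \<Rightarrow> nat set" where
  "goal_vars G = (\<Union>l\<in>set G. lvars l)"

definition goal_subst :: "('f, 'p) lit list \<Rightarrow> 'f sub \<Rightarrow> ('f, 'p) lit list" where
  "goal_subst G s = map (\<lambda>l. lsubst l s) G"

text \<open>\<open>sldnf_succ L q G r\<close>: the goal \<open>G\<close> has a successful SLDNF derivation with leftmost selection,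
  along which the query instance \<open>q\<close> is further instantiated to \<open>r\<close>. Carrying the instance
  amounts to composing the mgus and applying the computed answer to the query; program clauses
  are standardized apart from the current instance and goal. \<open>sldnf_fail L G\<close>: the goal
  has a finitely failed SLDNF tree. The tree has one child per program clause applicable to the
  selected atom, and since \<open>L\<close> may be infinite, finite branching has to be demanded explicitly.
  A selected non-ground negative literal flounders: neither relation holds.\<close>

inductive sldnf_succ ::
    "('f, 'p) clause set \<Rightarrow> ('f, 'p) atom list \<Rightarrow> ('f, 'p) lit list \<Rightarrow> ('f, 'p) atom list \<Rightarrow> bool"
  and sldnf_fail :: "('f, 'p) clause set \<Rightarrow> ('f, 'p) lit list \<Rightarrow> bool"
  for L :: "('f, 'p) clause set" where
  succ_empty: "sldnf_succ L q [] q"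
| succ_pos:
    "\<lbrakk>C \<in> L; variant_of C' C; cvars C' \<inter> (qvars q \<union> goal_vars (Pos a # G)) = {};
      is_mgu s a (head C'); sldnf_succ L (qsubst q s) (goal_subst (body C' @ G) s) r\<rbrakk>
     \<Longrightarrow> sldnf_succ L q (Pos a # G) r"
| succ_neg:
    "\<lbrakk>avars a = {}; sldnf_fail L [Pos a]; sldnf_succ L q G r\<rbrakk> \<Longrightarrow> sldnf_succ L q (Neg a # G) r"
| fail_pos:
    "\<lbrakk>finite {C \<in> L. unifiable_apart a (head C)};
      \<And>C. \<lbrakk>C \<in> L; unifiable_apart a (head C)\<rbrakk> \<Longrightarrow>
        \<exists>C' s. variant_of C' C \<and> cvars C' \<inter> goal_vars (Pos a # G) = {} \<and>
          is_mgu s a (head C') \<and> sldnf_fail L (goal_subst (body C' @ G) s)\<rbrakk>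
     \<Longrightarrow> sldnf_fail L (Pos a # G)"
| fail_neg_succ:
    "\<lbrakk>avars a = {}; sldnf_succ L [a] [Pos a] r\<rbrakk> \<Longrightarrow> sldnf_fail L (Neg a # G)"
| fail_neg:
    "\<lbrakk>avars a = {}; sldnf_fail L [Pos a]; sldnf_fail L G\<rbrakk> \<Longrightarrow> sldnf_fail L (Neg a # G)"

text \<open>SLDNF resolution is a procedure for normal programs, so an answer of a probabilistic
  program is one obtained in some world.\<close>

definition answer ::
    "('f \<times> nat) set \<Rightarrow> ('f, 'p) plp \<Rightarrow> ('f, 'p) atom list \<Rightarrow> ('f, 'p) atom list \<Rightarrow> bool" where
  "answer S P q r \<longleftrightarrow>
     (\<exists>w\<in>total_choices S P. sldnf_succ (world_program P w) q (map Pos q) r)"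

end

theory Submission
  imports Defs
begin

text \<open>Groundness of answers is an invariant of resolution with range-restricted clauses. The
  measure on worlds is a product of Bernoulli measures. The difficulty is that the truth of an
  atom is an event: the well-founded model is reached by a transfinite iteration, and without
  further assumptions truth in it is only co-analytic. If the well-founded model of every world
  is two-valued, it is the unique stable model of the world. Truth and untruth of an atom are
  then both of the form ``some stable model contains, respectively omits, the atom'', hence
  projections of closed sets of pairs of a world and a certificate for a stable model.
  Since they are complementary, separating them as in Lusin's theorem shows them to be measurable.\<close>

section \<open>Substitutions and groundness of answers\<close>

text \<open>Stability by itself need not be a closed condition either: support of an atom asks for
  the existence of a clause, foundedness excludes infinite descent. Storing a clause and a rank
  makes both a matter of finitely many values. Uniqueness of the stable model enters as follows. If
  the worlds with the atom and those without it were inseparable, refinement would yield two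
  coordinate sequences, each of whose finite parts extends to a certified world. By closedness both
  limits are certified worlds, one with the atom and one without. They therefore differ in an atomic
  choice, and the cylinder of that choice already separates the pieces at a finite stage, a
  contradiction.\<close>

lemma tvars_tsubst: "tvars (tsubst t s) = (\<Union>x\<in>tvars t. tvars (s x))"
  by (induction t) auto

lemma tsubst_tsubst: "tsubst (tsubst t s) u = tsubst t (\<lambda>x. tsubst (s x) u)"
  by (induction t) auto

lemma tsubst_cong: "(\<And>x. x \<in> tvars t \<Longrightarrow> s x = u x) \<Longrightarrow> tsubst t s = tsubst t u"
  by (induction t) auto

lemma tsubst_Var: "tsubst t Var = t"
  by (induction t) (auto simp: map_idI)

lemma wf_tsubst:
  "wf_trm S t \<Longrightarrow> (\<And>x. x \<in> tvars t \<Longrightarrow> wf_trm S (s x)) \<Longrightarrow> wf_trm S (tsubst t s)"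
  by (induction t) auto

lemma avars_asubst: "avars (asubst a s) = (\<Union>x\<in>avars a. tvars (s x))"
  by (cases a) (auto simp: tvars_tsubst)

lemma asubst_asubst: "asubst (asubst a s) u = asubst a (\<lambda>x. tsubst (s x) u)"
  by (cases a) (auto simp: tsubst_tsubst)

lemma asubst_cong: "(\<And>x. x \<in> avars a \<Longrightarrow> s x = u x) \<Longrightarrow> asubst a s = asubst a u"
  by (cases a) (auto intro!: tsubst_cong)

lemma asubst_Var: "asubst a Var = a"
  by (cases a) (auto simp: tsubst_Var map_idI)

lemma asubst_ground: "avars a = {} \<Longrightarrow> asubst a s = a"
  using asubst_cong[of a s Var] by (simp add: asubst_Var)

lemma wf_asubst:
  "wf_atom S a \<Longrightarrow> (\<And>x. x \<in> avars a \<Longrightarrow> wf_trm S (s x)) \<Longrightarrow> wf_atom S (asubst a s)"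
  by (cases a) (auto intro!: wf_tsubst)

lemma lit_atom_lsubst: "lit_atom (lsubst l s) = asubst (lit_atom l) s"
  by (cases l) auto

lemma lsubst_cong: "(\<And>x. x \<in> lvars l \<Longrightarrow> s x = u x) \<Longrightarrow> lsubst l s = lsubst l u"
  by (cases l) (auto simp: lvars_def intro!: asubst_cong)

lemma csubst_cong: "(\<And>x. x \<in> cvars C \<Longrightarrow> s x = u x) \<Longrightarrow> csubst C s = csubst C u"
  by (auto simp: csubst_def cvars_def intro!: asubst_cong lsubst_cong)

lemma qvars_qsubst: "qvars (qsubst q s) = (\<Union>x\<in>qvars q. tvars (s x))"
  by (auto simp: qvars_def qsubst_def avars_asubst)

lemma qsubst_qsubst: "qsubst (qsubst q s) u = qsubst q (\<lambda>x. tsubst (s x) u)"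
  by (simp add: qsubst_def asubst_asubst)

lemma qsubst_Var: "qsubst q Var = q"
  by (simp add: qsubst_def asubst_Var map_idI)

lemma Pos_eq_lsubst: "Pos b = lsubst l s \<longleftrightarrow> (\<exists>a. l = Pos a \<and> b = asubst a s)"
  by (cases l) auto

lemma pos_vars_subst: "pos_vars (map (\<lambda>l. lsubst l s) G) = (\<Union>x\<in>pos_vars G. tvars (s x))"
  by (force simp: pos_vars_def image_iff Pos_eq_lsubst avars_asubst)

lemma pos_vars_append: "pos_vars (G @ H) = pos_vars G \<union> pos_vars H"
  by (auto simp: pos_vars_def)

lemma pos_vars_Pos: "pos_vars (Pos a # G) = avars a \<union> pos_vars G"
  by (auto simp: pos_vars_def)

lemma pos_vars_Neg: "pos_vars (Neg a # G) = pos_vars G"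
  by (auto simp: pos_vars_def)

lemma finite_tvars: "finite (tvars t)"
  by (induction t) auto

lemma finite_avars: "finite (avars a)"
  by (cases a) (auto simp: finite_tvars)

lemma finite_cvars: "finite (cvars C)"
  by (auto simp: cvars_def lvars_def finite_avars)

text \<open>The invariant of the derivation is that every variable of the query instance occurs in a
  positive literal of the goal; the empty goal then leaves a ground instance.\<close>

lemma sldnf_succ_ground_instance:
  assumes "sldnf_succ L q G r"
    and L: "\<And>C. C \<in> L \<Longrightarrow> avars (head C) \<subseteq> pos_vars (body C)"
    and "qvars q \<subseteq> pos_vars G"
  shows "ground_instance q r"
proof -
  have "qvars q \<subseteq> pos_vars G \<longrightarrow> ground_instance q r" using assms(1)
  \<comment> \<open>The failure relation gets the trivial property: a selected negative literal is
    ground and binds nothing, and its removal leaves \<open>pos_vars\<close> unchanged.\<close>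
  proof (induction rule: sldnf_succ_sldnf_fail.inducts(1)[where ?P2.0 = "\<lambda>_. True"])
    case (succ_empty q)
    have "q = qsubst q Var" by (simp add: qsubst_Var)
    then show ?case by (auto simp: ground_instance_def pos_vars_def)
  next
    case (succ_pos C C' q a G s r)
    obtain v where C': "C' = csubst C (\<lambda>x. Var (v x))"
      using succ_pos by (auto simp: variant_of_def)
    have hd: "avars (head C') \<subseteq> pos_vars (body C')"
      using L[OF succ_pos(1)] by (auto simp: C' csubst_def avars_asubst pos_vars_subst)
    show ?case
    proof
      assume q: "qvars q \<subseteq> pos_vars (Pos a # G)"
      \<comment> \<open>After the mgu, \<open>a\<close> and the head have the same variables, so by
        range restriction the variables lost with \<open>a\<close> are carried on by positive body
        literals of \<open>C'\<close>.\<close>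
      have "asubst a s = asubst (head C') s" using succ_pos by (simp add: is_mgu_def)
      then have "(\<Union>x\<in>avars a. tvars (s x)) = (\<Union>x\<in>avars (head C'). tvars (s x))"
        by (metis avars_asubst)
      also have "\<dots> \<subseteq> (\<Union>x\<in>pos_vars (body C'). tvars (s x))"
        using hd by (rule UN_mono) simp
      finally have "(\<Union>x\<in>avars a. tvars (s x)) \<subseteq> (\<Union>x\<in>pos_vars (body C'). tvars (s x))" .
      then have "qvars (qsubst q s) \<subseteq> pos_vars (goal_subst (body C' @ G) s)"
        using q by (fastforce simp: qvars_qsubst goal_subst_def pos_vars_subst[unfolded map_append] pos_vars_append pos_vars_Pos)
      with succ_pos show "ground_instance q r"
        by (auto simp: ground_instance_def qsubst_qsubst)
    qed
  qed (auto simp: pos_vars_Neg)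
  with assms(3) show ?thesis by simp
qed

lemma groundings_ground:
  assumes "th \<in> groundings S a"
  shows "avars (asubst a (sub_of th)) = {}"
proof -
  have "tvars (sub_of th x) = {}" if "x \<in> avars a" for x
  proof -
    from that assms obtain t where "th x = Some t" by (auto simp: groundings_def)
    then show ?thesis
      using assms by (auto simp: groundings_def sub_of_def herbrand_universe_def ran_def)
  qed
  then show ?thesis by (auto simp: avars_asubst)
qed

text \<open>The initial goal is the query itself, all positive, so the invariant holds at the start.
  A selected fact has an empty body and still meets the condition on clauses, because its grounding
  leaves no variable in the head.\<close>

lemma answer_ground_instance:
  assumes "range_restricted P" "answer S P q r"
  shows "ground_instance q r"
proof -
  obtain w where w: "w \<in> total_choices S P"
      "sldnf_succ (world_program P w) q (map Pos q) r"
    using assms(2) by (auto simp: answer_def)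
  show ?thesis
  proof (rule sldnf_succ_ground_instance[OF w(2)])
    fix C assume "C \<in> world_program P w"
    then show "avars (head C) \<subseteq> pos_vars (body C)"
      using assms(1) w(1) groundings_ground
      by (fastforce simp: world_program_def range_restricted_def total_choices_def
          composite_choice_def atomic_choices_def)
  qed (auto simp: qvars_def pos_vars_def)
qed

section \<open>Countability\<close>

text \<open>The type of function symbols may be uncountable, so the argument goes by stages over
  \<open>S\<close>. The stages disregard arities: a countable superset is enough.\<close>

lemma countable_wf_trm:
  assumes "countable S"
  shows "countable {t. wf_trm S t}"
proof -
  define T where "T = rec_nat {} (\<lambda>_ A. range Var \<union> (\<lambda>(f, ts). Fun f ts) ` (fst ` S \<times> lists A))"
  have T_Suc: "T (Suc n) = range Var \<union> (\<lambda>(f, ts). Fun f ts) ` (fst ` S \<times> lists (T n))" for n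
    by (simp add: T_def)
  have count: "countable (T n)" for n
  proof (induction n)
    case 0
    show ?case by (simp add: T_def)
  next
    case (Suc n)
    then show ?case unfolding T_Suc using assms by (intro countable_Un countable_image) auto
  qed
  have step: "T n \<subseteq> T (Suc n)" for n
  proof (induction n)
    case 0
    show ?case by (simp add: T_def)
  next
    case (Suc n)
    let ?F = "\<lambda>A. range Var \<union> (\<lambda>(f, ts). Fun f ts) ` (fst ` S \<times> lists A)"
    have "?F (T n) \<subseteq> ?F (T (Suc n))"
      by (intro Un_mono order_refl image_mono Sigma_mono lists_mono Suc)
    then show ?case by (simp only: T_Suc[symmetric])
  qed
  have mono: "T m \<subseteq> T n" if "m \<le> n" for m n
    using lift_Suc_mono_le[of T, OF step that] .
  have "wf_trm S t \<Longrightarrow> \<exists>n. t \<in> T n" for t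
  proof (induction t)
    case (Var x)
    have "Var x \<in> T (Suc 0)" by (simp add: T_Suc)
    then show ?case ..
  next
    case (Fun f ts)
    then obtain k where k: "\<And>t. t \<in> set ts \<Longrightarrow> t \<in> T (k t)" by simp metis
    \<comment> \<open>The sum is a convenient common upper bound for the stages of the
      arguments.\<close>
    have "t \<in> T (\<Sum>t\<in>set ts. k t)" if "t \<in> set ts" for t
      using k[OF that] mono[of "k t" "\<Sum>t\<in>set ts. k t"] member_le_sum[OF that, of k] by auto
    then have "Fun f ts \<in> T (Suc (\<Sum>t\<in>set ts. k t))"
      using Fun.prems by (force simp: T_Suc)
    then show ?case ..
  qed
  then have "{t. wf_trm S t} \<subseteq> (\<Union>n. T n)" by auto
  then show ?thesis by (rule countable_subset) (simp add: count)
qed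

text \<open>A map with finite domain is recovered from the list of its values along an enumeration
  of that domain.\<close>

lemma countable_maps:
  assumes "finite V" "countable T"
  shows "countable {th :: 'a \<rightharpoonup> 'b. dom th = V \<and> ran th \<subseteq> T}"
proof -
  obtain xs where xs: "set xs = V" "distinct xs" using finite_distinct_list[OF assms(1)] by auto
  have "th \<in> (\<lambda>ts. map_of (zip xs ts)) ` lists T" if "dom th = V" "ran th \<subseteq> T" for th :: "'a \<rightharpoonup> 'b"
  proof (rule image_eqI)
    show "th = map_of (zip xs (map (\<lambda>x. the (th x)) xs))"
      using that xs by (fastforce simp: map_of_zip_map)
    show "map (\<lambda>x. the (th x)) xs \<in> lists T" using that xs by (fastforce simp: ran_def)
  qed
  then have "{th. dom th = V \<and> ran th \<subseteq> T} \<subseteq> (\<lambda>ts. map_of (zip xs ts)) ` lists T" by auto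
  then show ?thesis by (rule countable_subset) (use assms in auto)
qed

lemma countable_herbrand_universe: "countable S \<Longrightarrow> countable (herbrand_universe S)"
  by (rule countable_subset[OF _ countable_wf_trm]) (auto simp: herbrand_universe_def)

lemma countable_groundings: "countable S \<Longrightarrow> countable (groundings S a)"
  unfolding groundings_def by (intro countable_maps finite_avars countable_herbrand_universe)

lemma countable_ground_program:
  assumes "countable S" "countable L"
  shows "countable (ground_program S L)"
proof -
  \<comment> \<open>There may be uncountably many total substitutions, but an instance depends only
    on their values at the finitely many variables of the clause.\<close>
  have "csubst C s \<in> (\<lambda>th. csubst C (sub_of th)) ` {th. dom th = cvars C \<and> ran th \<subseteq> herbrand_universe S}"
    if "\<forall>x\<in>cvars C. s x \<in> herbrand_universe S" for C :: "('a, 'b) clause" and s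
  proof (rule image_eqI)
    let ?th = "\<lambda>x. if x \<in> cvars C then Some (s x) else None"
    show "csubst C s = csubst C (sub_of ?th)" by (rule csubst_cong) (simp add: sub_of_def)
    show "?th \<in> {th. dom th = cvars C \<and> ran th \<subseteq> herbrand_universe S}"
      using that by (auto simp: dom_def ran_def split: if_splits)
  qed
  then have "ground_program S L \<subseteq>
      (\<Union>C\<in>L. (\<lambda>th. csubst C (sub_of th)) ` {th. dom th = cvars C \<and> ran th \<subseteq> herbrand_universe S})"
    by (auto simp: ground_program_def)
  then show ?thesis
    by (rule countable_subset)
      (intro countable_UN countable_image countable_maps finite_cvars
        countable_herbrand_universe assms)
qed

section \<open>Well-founded models and stable models\<close>

text \<open>Disjointness of the two parts of a stage would not pass through the supremum case of the
  induction: it concerns arbitrary suprema, and two consistent interpretations may clash with each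
  other. Comparison with the fixed limit \<open>I\<close> does pass through.\<close>

lemma wf_model_consistent:
  fixes G :: "('f, 'p) clause set" and S
  defines "I \<equiv> lfp (wf_op S G)"
  shows "fst I \<inter> snd I = {}"
proof -
  have fix_I: "wf_op S G I = I" unfolding I_def using lfp_fixpoint[OF wf_op_mono] by blast
  have unf: "unfounded_set G K (greatest_unfounded S G K)" for K
    unfolding greatest_unfounded_def unfounded_set_def by blast
  have sndI: "unfounded_set G I (snd I)" using unf[of I] fix_I by (simp add: wf_op_def prod_eq_iff)
  let ?P = "\<lambda>K. fst K \<inter> snd I = {} \<and> snd K \<inter> fst I = {}"
  have "?P (lfp (wf_op S G))"
    \<comment> \<open>The invariant compares the stage with the limit. Positive loops through the greatest
      unfounded set of a stage are excluded by a second induction on the stages.\<close>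
  proof (induction rule: lfp_ordinal_induct[OF wf_op_mono])
    case (1 K)
    define U where "U = greatest_unfounded S G K"
    have U: "unfounded_set G K U" using unf by (simp add: U_def)
    have KI: "fst K \<subseteq> fst I" "snd K \<subseteq> snd I" using 1(2) by (auto simp: I_def less_eq_prod_def)
    have "fst (lfp (wf_op S G)) \<inter> U = {}"
    proof (induction rule: lfp_ordinal_induct[OF wf_op_mono])
      case (1 K')
      have K'I: "fst K' \<subseteq> fst I" "snd K' \<subseteq> snd I" using 1(2) by (auto simp: I_def less_eq_prod_def)
      have False if a: "C \<in> G" "\<forall>l\<in>set (body C). lit_true K' l" "head C \<in> U" for C
      proof -
        from U a(1,3) consider l where "l \<in> set (body C)" "lit_false K l"
          | b where "b \<in> U" "Pos b \<in> set (body C)" unfolding unfounded_set_def by blast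
        then show False
        proof cases
          case (1 l)
          then have "lit_true K' l" using a(2) by blast
          with 1(2) K'I KI \<open>?P K\<close> show False by (cases l; simp) blast+
        next
          case 2
          then have "b \<in> fst K'" using bspec[OF a(2), of "Pos b"] by simp
          with 2(1) \<open>fst K' \<inter> U = {}\<close> show False by blast
        qed
      qed
      then show ?case by (auto simp: wf_op_def consequences_def)
    next
      case (2 N)
      then show ?case by (auto simp: fst_Sup)
    qed
    then have U_fst: "U \<inter> fst I = {}" by (auto simp: I_def)
    \<comment> \<open>\<open>snd I\<close> is unfounded with respect to \<open>I\<close>, as
      \<open>I\<close> is a fixed point. A clause firing at \<open>K\<close> with its head there
      would contain a literal true at \<open>K\<close> and false at \<open>I\<close>, or a positive
      atom in both \<open>fst K\<close> and \<open>snd I\<close>.\<close>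
    have False if a: "C \<in> G" "\<forall>l\<in>set (body C). lit_true K l" "head C \<in> snd I" for C
    proof -
      from sndI a(1,3) consider l where "l \<in> set (body C)" "lit_false I l"
        | b where "b \<in> snd I" "Pos b \<in> set (body C)" unfolding unfounded_set_def by blast
      then show False
      proof cases
        case (1 l)
        then have "lit_true K l" using a(2) by blast
        with 1(2) KI \<open>?P K\<close> show False by (cases l; simp) blast+
      next
        case 2
        then have "b \<in> fst K" using bspec[OF a(2), of "Pos b"] by simp
        with 2(1) \<open>?P K\<close> show False by blast
      qed
    qed
    with U_fst show ?case by (auto simp: wf_op_def consequences_def U_def)
  next
    case (2 N)
    then show ?case by (auto simp: fst_Sup snd_Sup)
  qed
  then show ?thesis by (simp add: I_def)
qed

definition body_true :: "('f, 'p) atom set \<Rightarrow> ('f, 'p) clause \<Rightarrow> bool" where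
  "body_true M C \<longleftrightarrow> (\<forall>l\<in>set (body C). lit_true (M, - M) l)"

text \<open>A certificate describes a stable model as its domain: every atom of the model is
  assigned a rank and a supporting clause whose positive body atoms have lower rank. Each of
  the conditions involves finitely many values of the certificate, which makes the set of
  pairs of a world and a certificate closed. Clauses are labelled in order to tell
  apart the probabilistic facts with the same ground instance.\<close>

definition certificate ::
    "'l set \<Rightarrow> ('l \<Rightarrow> ('f, 'p) clause) \<Rightarrow> (('f, 'p) atom \<rightharpoonup> nat \<times> 'l) \<Rightarrow> bool" where
  "certificate A cl h \<longleftrightarrow>
     (\<forall>l\<in>A. body_true (dom h) (cl l) \<longrightarrow> head (cl l) \<in> dom h) \<and>
     (\<forall>b n l. h b = Some (n, l) \<longrightarrow> l \<in> A \<and> head (cl l) = b \<and> body_true (dom h) (cl l) \<and>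
        (\<forall>c. Pos c \<in> set (body (cl l)) \<longrightarrow> (\<exists>m k. h c = Some (m, k) \<and> m < n)))"

text \<open>Closure under the rules bounds the true part from above. Ranks keep \<open>dom h\<close>
  out of every unfounded set: the true supporting clause of an atom in such a set would supply
  another member of strictly lower rank.\<close>

lemma certificate_wf_model:
  fixes cl :: "'l \<Rightarrow> ('f, 'p) clause" and S
  assumes h: "certificate A cl h"
  defines "I \<equiv> lfp (wf_op S (cl ` A))"
  shows "fst I \<subseteq> dom h \<and> snd I \<inter> dom h = {}"
  unfolding I_def
proof (induction rule: lfp_ordinal_induct[OF wf_op_mono])
  case (1 K)
  have "consequences (cl ` A) K \<subseteq> dom h"
  proof
    fix b assume "b \<in> consequences (cl ` A) K"
    then obtain l where l: "l \<in> A" "b = head (cl l)" "\<forall>x\<in>set (body (cl l)). lit_true K x"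
      by (auto simp: consequences_def)
    have "lit_true (dom h, - dom h) x" if "lit_true K x" for x
      using that 1(1) by (cases x) auto
    with l h show "b \<in> dom h" unfolding certificate_def body_true_def by blast
  qed
  moreover have rank: "b \<notin> U" if U: "unfounded_set (cl ` A) K U" and "h b = Some (n, l)" for U b n l
    using that(2)
  proof (induction n arbitrary: b l rule: less_induct)
    case (less n)
    have l: "l \<in> A" "head (cl l) = b" "body_true (dom h) (cl l)"
      "\<And>c. Pos c \<in> set (body (cl l)) \<Longrightarrow> \<exists>m k. h c = Some (m, k) \<and> m < n"
      using h less.prems unfolding certificate_def by blast+
    show ?case
    proof
      assume "b \<in> U"
      with U l(1,2) consider x where "x \<in> set (body (cl l))" "lit_false K x"
          | c where "c \<in> U" "Pos c \<in> set (body (cl l))" unfolding unfounded_set_def by blast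
      then show False
      proof cases
        case (1 x)
        then have "lit_true (dom h, - dom h) x" using l(3) by (auto simp: body_true_def)
        with 1(2) \<open>fst K \<subseteq> dom h \<and> snd K \<inter> dom h = {}\<close> show False
          by (cases x) auto
      next
        case 2
        then show False using l(4) less.IH by blast
      qed
    qed
  qed
  have "U \<inter> dom h = {}" if "unfounded_set (cl ` A) K U" for U
    using rank[OF that] by auto
  then have "greatest_unfounded S (cl ` A) K \<inter> dom h = {}"
    unfolding greatest_unfounded_def by blast
  ultimately show ?case by (simp add: wf_op_def)
next
  case (2 N)
  then show ?case by (auto simp: fst_Sup snd_Sup)
qed

text \<open>In the two-valued case, falsity of a base atom in \<open>I\<close> is absence from
  \<open>T\<close>. Hence \<open>T\<close> is the least model of its Gelfond-Lifschitz reduct,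
  generated by iterating the rules with negative literals read in \<open>T\<close>; the stage at
  which an atom first appears becomes its rank.\<close>

lemma certificate_exists:
  fixes cl :: "'l \<Rightarrow> ('f, 'p) clause" and S A
  defines "I \<equiv> lfp (wf_op S (cl ` A))"
  assumes total: "fst I \<union> snd I = herbrand_base S"
    and base: "\<And>l x. l \<in> A \<Longrightarrow> x \<in> set (body (cl l)) \<Longrightarrow> lit_atom x \<in> herbrand_base S"
  shows "\<exists>h. certificate A cl h"
proof -
  define T where "T = fst I"
  have cons: "fst I \<inter> snd I = {}" unfolding I_def by (rule wf_model_consistent)
  have fix_I: "wf_op S (cl ` A) I = I" unfolding I_def using lfp_fixpoint[OF wf_op_mono] by blast
  then have fstI: "consequences (cl ` A) I = T"
    and sndI: "greatest_unfounded S (cl ` A) I = snd I"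
    by (simp_all add: wf_op_def T_def prod_eq_iff)
  have tr: "lit_true I x \<longleftrightarrow> lit_true (T, - T) x"
    and fl: "lit_false I x \<longleftrightarrow> \<not> lit_true (T, - T) x" if "lit_atom x \<in> herbrand_base S" for x
    using that total cons by (cases x; auto simp: T_def)+
  have head_T: "head (cl l) \<in> T" if "l \<in> A" "\<And>x. x \<in> set (body (cl l)) \<Longrightarrow> lit_true (T, - T) x" for l
  proof -
    have "\<forall>x\<in>set (body (cl l)). lit_true I x" using that tr base by blast
    then show ?thesis using that(1) unfolding fstI[symmetric] consequences_def by blast
  qed
  define St where "St = rec_nat {} (\<lambda>_ X. {head (cl l) | l. l \<in> A \<and>
      (\<forall>x\<in>set (body (cl l)). lit_true (X, - T) x)})"
  have St_0: "St 0 = {}" by (simp add: St_def)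
  have St_Suc: "St (Suc n) = {head (cl l) | l. l \<in> A \<and>
      (\<forall>x\<in>set (body (cl l)). lit_true (St n, - T) x)}" for n
    by (simp add: St_def)
  have lm: "lit_true (X, - T) x \<Longrightarrow> X \<subseteq> Y \<Longrightarrow> lit_true (Y, - T) x" for X Y x by (cases x) auto
  have step: "St n \<subseteq> St (Suc n)" for n
  proof (induction n)
    case (Suc n)
    then show ?case unfolding St_Suc[of "Suc n"] St_Suc[of n] using lm by blast
  qed (simp add: St_0)
  have mono: "St m \<subseteq> St n" if "m \<le> n" for m n
    using lift_Suc_mono_le[of St, OF step that] .
  have St_T: "St n \<subseteq> T" for n
  proof (induction n)
    case (Suc n)
    then show ?case unfolding St_Suc using head_T lm[of "St n" _ T] by blast
  qed (simp add: St_0)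
  \<comment> \<open>Bodies are finite, so omega stages suffice for closure.\<close>
  have closed: "head (cl l) \<in> (\<Union>n. St n)"
    if l: "l \<in> A" "\<forall>x\<in>set (body (cl l)). lit_true (\<Union>n. St n, - T) x" for l
  proof -
    have "\<forall>x\<in>set (body (cl l)). \<exists>n. lit_true (St n, - T) x"
    proof
      fix x assume "x \<in> set (body (cl l))"
      with l(2) have "lit_true (\<Union>n. St n, - T) x" by blast
      then show "\<exists>n. lit_true (St n, - T) x" by (cases x) auto
    qed
    then obtain k where k: "\<And>x. x \<in> set (body (cl l)) \<Longrightarrow> lit_true (St (k x), - T) x" by metis
    let ?n = "\<Sum>x\<in>set (body (cl l)). k x"
    have "lit_true (St ?n, - T) x" if "x \<in> set (body (cl l))" for x
      using lm[OF k[OF that] mono] member_le_sum[OF that, of k] by simp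
    then have "head (cl l) \<in> St (Suc ?n)" unfolding St_Suc using l(1) by blast
    then show ?thesis by blast
  qed
  \<comment> \<open>Every clause for an atom of \<open>T\<close> that is never generated has a
    literal failing in the union of the stages. Either it fails in \<open>T\<close> too and is false
    in \<open>I\<close>, or it is a positive atom that is itself never generated. The remainder is
    thus unfounded and, by consistency, empty.\<close>
  have "unfounded_set (cl ` A) I (T - (\<Union>n. St n))" unfolding unfounded_set_def
  proof (intro ballI impI)
    fix a C assume a: "a \<in> T - (\<Union>n. St n)" "C \<in> cl ` A" "head C = a"
    then obtain l where l: "l \<in> A" "C = cl l" by blast
    with a closed obtain x where x: "x \<in> set (body C)" "\<not> lit_true (\<Union>n. St n, - T) x" by blast
    show "(\<exists>l\<in>set (body C). lit_false I l) \<or> (\<exists>b\<in>T - (\<Union>n. St n). Pos b \<in> set (body C))"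
    proof (cases "lit_true (T, - T) x")
      case True
      then show ?thesis using x by (cases x) auto
    next
      case False
      then show ?thesis using fl x l base by blast
    qed
  qed
  moreover have "T - (\<Union>n. St n) \<subseteq> herbrand_base S" using total by (auto simp: T_def)
  ultimately have "T - (\<Union>n. St n) \<subseteq> snd I"
    unfolding sndI[symmetric] greatest_unfounded_def by blast
  then have T: "T = (\<Union>n. St n)" using cons St_T by (auto simp: T_def)
  \<comment> \<open>On \<open>T\<close> the rank is positive because \<open>St 0\<close> is empty; a
    clause firing at the preceding stage has all its positive atoms at lower rank.\<close>
  define rk where "rk b = (LEAST n. b \<in> St n)" for b
  have "\<exists>l. l \<in> A \<and> head (cl l) = b \<and> body_true T (cl l) \<and>
      (\<forall>c. Pos c \<in> set (body (cl l)) \<longrightarrow> c \<in> T \<and> rk c < rk b)" if "b \<in> T" for b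
  proof -
    from that obtain n where "b \<in> St n" unfolding T by blast
    then have rb: "b \<in> St (rk b)" unfolding rk_def by (rule LeastI)
    then obtain m where m: "rk b = Suc m" by (cases "rk b") (auto simp: St_0)
    with rb obtain l where l: "l \<in> A" "head (cl l) = b"
        "\<forall>x\<in>set (body (cl l)). lit_true (St m, - T) x"
      unfolding m St_Suc by blast
    have "c \<in> T \<and> rk c < rk b" if "Pos c \<in> set (body (cl l))" for c
    proof -
      have "c \<in> St m" using l(3) that by fastforce
      then have "rk c \<le> m" unfolding rk_def by (rule Least_le)
      then show ?thesis using m \<open>c \<in> St m\<close> St_T by auto
    qed
    moreover have "body_true T (cl l)" using l(3) lm[OF _ St_T] unfolding body_true_def by blast
    ultimately show ?thesis using l by blast
  qed
  then obtain sup where sup: "\<And>b. b \<in> T \<Longrightarrow> sup b \<in> A \<and> head (cl (sup b)) = b \<and>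
      body_true T (cl (sup b)) \<and>
      (\<forall>c. Pos c \<in> set (body (cl (sup b))) \<longrightarrow> c \<in> T \<and> rk c < rk b)"
    by metis
  define h where "h b = (if b \<in> T then Some (rk b, sup b) else None)" for b
  have "dom h = T" by (auto simp: h_def dom_def)
  moreover have "head (cl l) \<in> T" if "l \<in> A" "body_true T (cl l)" for l
    using that head_T by (auto simp: body_true_def)
  ultimately have "certificate A cl h"
    unfolding certificate_def using sup by (auto simp: h_def split: if_splits)
  then show ?thesis by (rule exI[of _ h])
qed

section \<open>Separation\<close>

definition separable :: "'w measure \<Rightarrow> 'w set \<Rightarrow> 'w set \<Rightarrow> bool" where
  "separable M X Y \<longleftrightarrow> (\<exists>B\<in>sets M. X \<subseteq> B \<and> Y \<inter> B = {})"

lemma inseparable_nonempty: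
  assumes "\<not> separable M X Y"
  shows "X \<noteq> {}" and "X \<subseteq> space M \<Longrightarrow> Y \<noteq> {}"
proof -
  show "X \<noteq> {}" using assms unfolding separable_def by (metis empty_subsetI inf_bot_right sets.empty_sets)
  show "Y \<noteq> {}" if "X \<subseteq> space M"
    using assms that unfolding separable_def by (metis inf_bot_left sets.top)
qed

text \<open>For each \<open>v\<close> the separators are intersected over all \<open>w\<close>; the
  results are united over \<open>v\<close>.\<close>

lemma separable_UN:
  assumes V: "countable V" and W: "countable W"
    and sep: "\<And>v w. v \<in> V \<Longrightarrow> w \<in> W \<Longrightarrow> separable M (X v) (Y w)"
    and sp: "\<And>v. v \<in> V \<Longrightarrow> X v \<subseteq> space M"
  shows "separable M (\<Union>v\<in>V. X v) (\<Union>w\<in>W. Y w)"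
proof -
  from sep obtain B where B: "\<And>v w. v \<in> V \<Longrightarrow> w \<in> W \<Longrightarrow>
      B v w \<in> sets M \<and> X v \<subseteq> B v w \<and> Y w \<inter> B v w = {}"
    unfolding separable_def by metis
  \<comment> \<open>For empty \<open>W\<close> the bare intersection is \<open>UNIV\<close>, which
    need not be measurable; intersecting with \<open>space M\<close> covers this case.\<close>
  define B' where "B' v = space M \<inter> (\<Inter>w\<in>W. B v w)" for v
  have "B' v \<in> sets M" if "v \<in> V" for v
  proof (cases "W = {}")
    case False
    then have "(\<Inter>w\<in>W. B v w) \<in> sets M" using W B that by (intro sets.countable_INT') auto
    then show ?thesis unfolding B'_def by (rule sets.Int[OF sets.top])
  qed (simp add: B'_def)
  then have "(\<Union>v\<in>V. B' v) \<in> sets M" using V by (intro sets.countable_UN'')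
  moreover have "X v \<subseteq> B' v" if "v \<in> V" for v
    unfolding B'_def using sp B that by (intro Int_greatest INT_greatest) auto
  then have "(\<Union>v\<in>V. X v) \<subseteq> (\<Union>v\<in>V. B' v)" by (rule UN_mono[OF order_refl])
  moreover have "Y w \<inter> B' v = {}" if "v \<in> V" "w \<in> W" for v w
    using B[OF that] that(2) unfolding B'_def by blast
  then have "(\<Union>w\<in>W. Y w) \<inter> (\<Union>v\<in>V. B' v) = {}" by blast
  ultimately show ?thesis unfolding separable_def by blast
qed

text \<open>The refinement argument of Lusin's separation theorem, for sets of points with countably
  many discrete coordinates \<open>u 0, u 1, \<dots>\<close>: an inseparable pair has inseparable pieces on
  which ever more coordinates are fixed.\<close>

lemma Lusin_refinement:
  fixes u :: "nat \<Rightarrow> 'z \<Rightarrow> 'v"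
  assumes V: "countable V" and u: "\<And>k z. z \<in> X \<union> Y \<Longrightarrow> u k z \<in> V"
    and sp: "f ` X \<subseteq> space M"
    and insep: "\<not> separable M (f ` X) (f ` Y)"
  obtains x y where "\<And>n. \<not> separable M (f ` {z \<in> X. \<forall>k<n. u k z = x k}) (f ` {z \<in> Y. \<forall>k<n. u k z = y k})"
proof -
  define XX where "XX Z s = {z \<in> Z. \<forall>k<length s. u k z = s ! k}" for Z s
  have XX_snoc: "XX Z (s @ [v]) = {z \<in> XX Z s. u (length s) z = v}" for Z s v
    by (auto simp: XX_def nth_append less_Suc_eq)
  define bad where "bad s t \<longleftrightarrow> \<not> separable M (f ` XX X s) (f ` XX Y t)" for s t
  \<comment> \<open>If all extensions by one coordinate were separable, splitting both sets by the
    value of the next coordinate would separate the pair through \<open>separable_UN\<close>. The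
    values on the two sides are chosen independently.\<close>
  have step: "\<exists>v w. bad (s @ [v]) (t @ [w])" if "bad s t" for s t
  proof (rule ccontr)
    assume neg: "\<nexists>v w. bad (s @ [v]) (t @ [w])"
    have split: "f ` XX Z s = (\<Union>v\<in>V. f ` XX Z (s @ [v]))" if Z: "Z \<subseteq> X \<union> Y" for Z s
    proof -
      have "u (length s) z \<in> V" if "z \<in> XX Z s" for z
        using that Z by (intro u) (auto simp: XX_def)
      then have "XX Z s = (\<Union>v\<in>V. XX Z (s @ [v]))" unfolding XX_snoc by blast
      then show ?thesis by (metis image_UN)
    qed
    have "separable M (\<Union>v\<in>V. f ` XX X (s @ [v])) (\<Union>w\<in>V. f ` XX Y (t @ [w]))"
    proof (rule separable_UN[OF V V])
      show "separable M (f ` XX X (s @ [v])) (f ` XX Y (t @ [w]))" for v w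
        using neg by (simp add: bad_def)
      show "f ` XX X (s @ [v]) \<subseteq> space M" for v using sp by (auto simp: XX_def)
    qed
    then show False using that split[of X s] split[of Y t] by (simp add: bad_def)
  qed
  define P where "P n p \<longleftrightarrow> bad (fst p) (snd p) \<and> length (fst p) = n \<and> length (snd p) = n" for n p
  define Q where "Q p p' \<longleftrightarrow> (\<exists>v w. p' = (fst p @ [v], snd p @ [w]))" for p p' :: "'v list \<times> 'v list"
  have "\<exists>g. \<forall>n. P n (g n) \<and> Q (g n) (g (Suc n))"
  proof (rule dependent_nat_choice)
    have "P 0 ([], [])" using insep by (simp add: P_def bad_def XX_def)
    then show "\<exists>p. P 0 p" ..
    fix p n assume p: "P n p"
    then obtain v w where "bad (fst p @ [v]) (snd p @ [w])"
      using step unfolding P_def by blast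
    then have "P (Suc n) (fst p @ [v], snd p @ [w])" using p by (simp add: P_def)
    then show "\<exists>p'. P (Suc n) p' \<and> Q p p'" unfolding Q_def by blast
  qed
  then obtain g where g: "\<And>n. P n (g n)" "\<And>n. Q (g n) (g (Suc n))" by blast
  \<comment> \<open>Stage \<open>Suc n\<close> is the first whose lists have an entry at position
    \<open>n\<close>; later stages only append.\<close>
  define x where "x n = fst (g (Suc n)) ! n" for n
  define y where "y n = snd (g (Suc n)) ! n" for n
  have gn: "fst (g n) = map x [0..<n] \<and> snd (g n) = map y [0..<n]" for n
  proof (induction n)
    case 0
    then show ?case using g(1)[of 0] by (simp add: P_def)
  next
    case (Suc n)
    obtain v w where vw: "g (Suc n) = (fst (g n) @ [v], snd (g n) @ [w])"
      using g(2)[of n] by (auto simp: Q_def)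
    moreover have "x n = v" "y n = w"
      using g(1)[of n] vw by (auto simp: x_def y_def P_def nth_append)
    ultimately show ?case using Suc by simp
  qed
  have "\<not> separable M (f ` {z \<in> X. \<forall>k<n. u k z = x k}) (f ` {z \<in> Y. \<forall>k<n. u k z = y k})" for n
    using g(1)[of n] gn[of n] by (simp add: P_def bad_def XX_def)
  then show thesis by (rule that)
qed

section \<open>The measure on worlds\<close>

text \<open>An atomic choice stripped of its outcome. These points index the Bernoulli factors and
  enumerate the bits of a world.\<close>

definition choice_points :: "('f \<times> nat) set \<Rightarrow> ('f, 'p) plp \<Rightarrow> (nat \<times> (nat \<rightharpoonup> 'f trm)) set" where
  "choice_points S P = {(i, th). i < length (pfacts P) \<and> th \<in> groundings S (snd (pfacts P ! i))}"

lemma total_choicesD: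
  assumes "w \<in> total_choices S P" "(i, th) \<in> choice_points S P"
  shows "(i, th, k) \<in> w \<longleftrightarrow> (k \<longleftrightarrow> (i, th, True) \<in> w)"
proof -
  have "\<exists>k'. (i, th, k') \<in> w" "\<not> ((i, th, False) \<in> w \<and> (i, th, True) \<in> w)"
    using assms unfolding total_choices_def composite_choice_def choice_points_def by blast+
  then obtain k' where "(i, th, k') \<in> w" "\<not> ((i, th, False) \<in> w \<and> (i, th, True) \<in> w)"
    by blast
  then show ?thesis by (cases k; cases k') auto
qed

lemma total_choices_points:
  "w \<in> total_choices S P \<Longrightarrow> (i, th, k) \<in> w \<Longrightarrow> (i, th) \<in> choice_points S P"
  by (auto simp: total_choices_def composite_choice_def choice_points_def atomic_choices_def)

lemma composite_choice_points:
  "composite_choice S P \<kappa> \<Longrightarrow> (i, th, k) \<in> \<kappa> \<Longrightarrow> (i, th) \<in> choice_points S P"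
  by (auto simp: composite_choice_def choice_points_def atomic_choices_def)

lemma composite_choice_unique:
  "composite_choice S P \<kappa> \<Longrightarrow> (i, th, k) \<in> \<kappa> \<Longrightarrow> (i, th, k') \<in> \<kappa> \<Longrightarrow> k = k'"
  unfolding composite_choice_def by (cases k; cases k') auto

lemma total_choices_eqI:
  assumes "w \<in> total_choices S P" "w' \<in> total_choices S P"
    and "\<And>i th. (i, th) \<in> choice_points S P \<Longrightarrow> (i, th, True) \<in> w \<longleftrightarrow> (i, th, True) \<in> w'"
  shows "w = w'"
proof -
  have "c \<in> w \<longleftrightarrow> c \<in> w'" for c
    using total_choices_points[OF assms(1)] total_choices_points[OF assms(2)]
      total_choicesD[OF assms(1)] total_choicesD[OF assms(2)] assms(3)
    by (cases c) metis
  then show ?thesis by blast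
qed

text \<open>It serves both to transport the product measure to worlds and to build a limit world
  from a sequence of bits. Values of \<open>A\<close> off the choice points are ignored.\<close>

definition world_of ::
    "('f \<times> nat) set \<Rightarrow> ('f, 'p) plp \<Rightarrow> (nat \<times> (nat \<rightharpoonup> 'f trm) \<Rightarrow> bool) \<Rightarrow> 'f achoice set" where
  "world_of S P A = {(i, th, k). (i, th) \<in> choice_points S P \<and> k = A (i, th)}"

lemma world_of_total: "world_of S P A \<in> total_choices S P"
  by (auto simp: world_of_def total_choices_def composite_choice_def choice_points_def
      atomic_choices_def)

lemma world_of_compatible:
  assumes "composite_choice S P \<kappa>"
  shows "world_of S P A \<in> compatible S P \<kappa> \<longleftrightarrow> (\<forall>(i, th, k)\<in>\<kappa>. A (i, th) = k)"
proof -
  have "c \<in> world_of S P A \<longleftrightarrow> (case c of (i, th, k) \<Rightarrow> A (i, th) = k)" if "c \<in> \<kappa>" for c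
    using composite_choice_points[OF assms] that by (cases c) (auto simp: world_of_def)
  then show ?thesis using world_of_total[of S P A] by (auto simp: compatible_def)
qed

definition cylinders :: "('f \<times> nat) set \<Rightarrow> ('f, 'p) plp \<Rightarrow> 'f achoice set set set" where
  "cylinders S P = {compatible S P \<kappa> | \<kappa>. finite \<kappa> \<and> composite_choice S P \<kappa>}"

lemma cylinders_subset: "cylinders S P \<subseteq> Pow (total_choices S P)"
  by (auto simp: cylinders_def compatible_def)

lemma composite_choice_empty: "composite_choice S P {}"
  by (simp add: composite_choice_def)

lemma total_in_cylinders: "total_choices S P \<in> cylinders S P"
  unfolding cylinders_def using composite_choice_empty
  by (force simp: compatible_def)

lemma world_measure_iff:
  "world_measure S P M \<longleftrightarrow> prob_space M \<and> space M = total_choices S P \<and>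
     sets M = sigma_sets (total_choices S P) (cylinders S P) \<and>
     (\<forall>\<kappa>. finite \<kappa> \<and> composite_choice S P \<kappa> \<longrightarrow>
        measure M (compatible S P \<kappa>) = finite_choice_prob P \<kappa>)"
  by (simp add: world_measure_def cylinders_def)

text \<open>Measures agreeing on an intersection-stable generator coincide. Contradictory choices
  give cylinders with empty intersection, so \<open>{}\<close> is added to the generator.\<close>

lemma world_measure_unique:
  assumes "world_measure S P M" "world_measure S P N"
  shows "M = N"
proof -
  interpret M: prob_space M using assms by (simp add: world_measure_iff)
  interpret N: prob_space N using assms by (simp add: world_measure_iff)
  let ?E = "insert {} (cylinders S P)"
  have sig: "sigma_sets (total_choices S P) ?E = sigma_sets (total_choices S P) (cylinders S P)"
    by (intro sigma_sets_eqI) (auto intro: sigma_sets.Empty)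
  have "Int_stable ?E"
  proof (rule Int_stableI)
    fix A B assume AB: "A \<in> ?E" "B \<in> ?E"
    show "A \<inter> B \<in> ?E"
    proof (cases "A = {} \<or> B = {}")
      case False
      with AB obtain \<kappa> \<kappa>' where k: "A = compatible S P \<kappa>" "finite \<kappa>" "composite_choice S P \<kappa>"
        "B = compatible S P \<kappa>'" "finite \<kappa>'" "composite_choice S P \<kappa>'"
        by (auto simp: cylinders_def)
      have AB_eq: "A \<inter> B = compatible S P (\<kappa> \<union> \<kappa>')" by (auto simp: k compatible_def)
      show ?thesis
      proof (cases "composite_choice S P (\<kappa> \<union> \<kappa>')")
        case True
        then show ?thesis using k(2,5) AB_eq by (auto simp: cylinders_def)
      next
        case False
        have "compatible S P (\<kappa> \<union> \<kappa>') = {}"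
        proof (rule ccontr)
          assume "compatible S P (\<kappa> \<union> \<kappa>') \<noteq> {}"
          then obtain w where "w \<in> total_choices S P" "\<kappa> \<union> \<kappa>' \<subseteq> w" by (auto simp: compatible_def)
          then have "composite_choice S P (\<kappa> \<union> \<kappa>')"
            unfolding total_choices_def composite_choice_def by blast
          with False show False ..
        qed
        then show ?thesis using AB_eq by simp
      qed
    qed auto
  qed
  moreover have "?E \<subseteq> Pow (total_choices S P)" using cylinders_subset[of S P] by auto
  moreover have "emeasure M X = emeasure N X" if "X \<in> ?E" for X
    using that assms by (auto simp: world_measure_iff cylinders_def M.emeasure_eq_measure
        N.emeasure_eq_measure)
  ultimately show ?thesis
    by (rule measure_eqI_generator_eq[where A = "\<lambda>_. total_choices S P"])
      (use assms sig total_in_cylinders[of S P] in \<open>auto simp: world_measure_iff\<close>)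
qed

text \<open>The measure is the image under \<open>world_of\<close> of a product of Bernoulli
  measures, one per choice point; preimages of cylinders are cylinders of the product.\<close>

lemma world_measure_exists:
  assumes "wf_plp S P"
  shows "\<exists>M. world_measure S P M"
proof -
  define pr where "pr j = fst (pfacts P ! fst j)" for j :: "nat \<times> (nat \<rightharpoonup> 'a trm)"
  have pr: "0 < pr j \<and> pr j \<le> 1" if "j \<in> choice_points S P" for j
  proof -
    have "pfacts P ! fst j \<in> set (pfacts P)" using that by (auto simp: choice_points_def)
    then show ?thesis using assms by (auto simp: wf_plp_def pr_def)
  qed
  define B where "B j = measure_pmf (bernoulli_pmf (pr j))" for j
  let ?J = "choice_points S P"
  interpret product_prob_space B ?J
    by (rule product_prob_spaceI) (simp add: B_def measure_pmf.prob_space_axioms)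
  let ?S = "sigma (total_choices S P) (cylinders S P)"
  define M where "M = distr (PiM ?J B) ?S (world_of S P)"
  define pt where "pt c = (fst c, fst (snd c))" for c :: "nat \<times> (nat \<rightharpoonup> 'a trm) \<times> bool"
  \<comment> \<open>For a composite choice this is a singleton at each point that
    \<open>\<kappa>\<close> decides, so \<open>E \<kappa>\<close> fixes exactly those
    coordinates.\<close>
  define sel where "sel \<kappa> j = {k. (fst j, snd j, k) \<in> \<kappa>}"
    for \<kappa> :: "(nat \<times> (nat \<rightharpoonup> 'a trm) \<times> bool) set" and j
  define E where "E \<kappa> = prod_emb ?J B (pt ` \<kappa>) (Pi\<^sub>E (pt ` \<kappa>) (sel \<kappa>))" for \<kappa>
  have pt: "pt ` \<kappa> \<subseteq> ?J" if "composite_choice S P \<kappa>" for \<kappa>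
    using composite_choice_points[OF that] by (auto simp: pt_def)
  have sel: "sel \<kappa> (pt c) = {snd (snd c)}" if "composite_choice S P \<kappa>" "c \<in> \<kappa>" for \<kappa> c
    using that composite_choice_unique[OF that(1), of "fst c" "fst (snd c)"]
    by (cases c) (auto simp: sel_def pt_def)
  have vim: "world_of S P -` compatible S P \<kappa> \<inter> space (PiM ?J B) = E \<kappa>"
    if k: "composite_choice S P \<kappa>" for \<kappa>
  proof (rule set_eqI)
    fix A
    have "A \<in> E \<kappa> \<longleftrightarrow> A \<in> space (PiM ?J B) \<and> (\<forall>c\<in>\<kappa>. A (pt c) \<in> sel \<kappa> (pt c))"
      unfolding E_def prod_emb_def space_PiM Int_iff vimage_eq restrict_PiE_iff by blast
    also have "(\<forall>c\<in>\<kappa>. A (pt c) \<in> sel \<kappa> (pt c)) \<longleftrightarrow> (\<forall>c\<in>\<kappa>. A (pt c) = snd (snd c))"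
      using sel[OF k] by (intro ball_cong) auto
    also have "\<dots> \<longleftrightarrow> world_of S P A \<in> compatible S P \<kappa>"
      by (simp add: world_of_compatible[OF k] pt_def case_prod_unfold)
    finally show "A \<in> world_of S P -` compatible S P \<kappa> \<inter> space (PiM ?J B) \<longleftrightarrow> A \<in> E \<kappa>" by blast
  qed
  have meas: "world_of S P \<in> measurable (PiM ?J B) ?S"
  proof (rule measurable_measure_of[OF cylinders_subset])
    show "world_of S P \<in> space (PiM ?J B) \<rightarrow> total_choices S P"
      by (intro Pi_I world_of_total)
    fix y assume "y \<in> cylinders S P"
    then obtain \<kappa> where k: "y = compatible S P \<kappa>" "finite \<kappa>" "composite_choice S P \<kappa>"
      by (auto simp: cylinders_def)
    have "E \<kappa> \<in> sets (PiM ?J B)" unfolding E_def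
      using k(2) pt[OF k(3)] by (intro sets_PiM_I) (auto simp: B_def)
    then show "world_of S P -` y \<inter> space (PiM ?J B) \<in> sets (PiM ?J B)"
      using vim[OF k(3)] k(1) by simp
  qed
  have "measure M (compatible S P \<kappa>) = finite_choice_prob P \<kappa>"
    if k: "finite \<kappa>" "composite_choice S P \<kappa>" for \<kappa>
  proof -
    \<comment> \<open>A composite choice decides each point at most once, so the product over points
      becomes the product over atomic choices.\<close>
    have inj: "inj_on pt \<kappa>"
    proof (rule inj_onI)
      fix x y assume "x \<in> \<kappa>" "y \<in> \<kappa>" "pt x = pt y"
      then have "snd (snd x) = snd (snd y)" using sel[OF k(2)] by (metis singleton_inject)
      with \<open>pt x = pt y\<close> show "x = y" by (auto simp: pt_def prod_eq_iff)
    qed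
    have "compatible S P \<kappa> \<in> sets ?S"
      using k cylinders_subset[of S P] by (auto simp: cylinders_def)
    then have "measure M (compatible S P \<kappa>) = measure (PiM ?J B) (E \<kappa>)"
      unfolding M_def by (simp add: measure_distr[OF meas] vim[OF k(2)])
    also have "\<dots> = (\<Prod>j\<in>pt ` \<kappa>. measure (B j) (sel \<kappa> j))"
      unfolding E_def using k(1) pt[OF k(2)] by (intro measure_PiM_emb) (auto simp: B_def)
    also have "\<dots> = (\<Prod>c\<in>\<kappa>. measure (B (pt c)) (sel \<kappa> (pt c)))"
      by (subst prod.reindex[OF inj]) simp
    also have "\<dots> = finite_choice_prob P \<kappa>" unfolding finite_choice_prob_def
    proof (rule prod.cong[OF refl])
      fix c assume c: "c \<in> \<kappa>"
      obtain i th b where c_eq: "c = (i, th, b)" by (cases c)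
      have "pt c \<in> ?J" using pt[OF k(2)] c by blast
      then have "0 < pr (pt c) \<and> pr (pt c) \<le> 1" by (rule pr)
      moreover have "sel \<kappa> (pt c) = {b}" using sel[OF k(2) c] by (simp add: c_eq)
      ultimately show "measure (B (pt c)) (sel \<kappa> (pt c)) =
          (case c of (i, th, k) \<Rightarrow> if k then fst (pfacts P ! i) else 1 - fst (pfacts P ! i))"
        by (cases b) (auto simp: c_eq B_def measure_pmf_single pr_def pt_def)
    qed
    finally show ?thesis .
  qed
  moreover have "prob_space M" unfolding M_def by (rule P.prob_space_distr[OF meas])
  moreover have "space M = total_choices S P" "sets M = sigma_sets (total_choices S P) (cylinders S P)"
    using cylinders_subset[of S P] by (simp_all add: M_def)
  ultimately show ?thesis unfolding world_measure_iff by blast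
qed

text \<open>An infinite choice is exhausted by finite segments, along which the measure is
  continuous from above. By monotonicity every finite subproduct bounds the measure from above, and
  the segments reach it in the limit, so it is the infimum.\<close>

lemma compatible_sets:
  assumes "world_measure S P M" "composite_choice S P \<kappa>" "countable \<kappa>"
  shows "compatible S P \<kappa> \<in> sets M" and "measure M (compatible S P \<kappa>) = choice_prob P \<kappa>"
proof -
  interpret prob_space M using assms by (simp add: world_measure_iff)
  have comp: "composite_choice S P F" if "F \<subseteq> \<kappa>" for F
    using assms(2) that unfolding composite_choice_def by blast
  have fin: "compatible S P F \<in> sets M" "measure M (compatible S P F) = finite_choice_prob P F"
    if "finite F" "F \<subseteq> \<kappa>" for F
    using that comp assms(1) by (auto simp: world_measure_iff cylinders_def)
  define F where "F n = {c \<in> \<kappa>. to_nat_on \<kappa> c < n}" for n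
  have "finite (F n)" for n
  proof (rule finite_imageD)
    show "finite (to_nat_on \<kappa> ` F n)" by (rule finite_subset[of _ "{..<n}"]) (auto simp: F_def)
    show "inj_on (to_nat_on \<kappa>) (F n)"
      using inj_on_to_nat_on[OF assms(3)] by (rule inj_on_subset) (auto simp: F_def)
  qed
  then have F: "finite (F n)" "F n \<subseteq> \<kappa>" for n by (auto simp: F_def)
  have kF: "\<kappa> = (\<Union>n. F n)" by (auto simp: F_def)
  have "compatible S P \<kappa> = (\<Inter>n. compatible S P (F n))"
    by (subst kF) (auto simp: compatible_def)
  moreover have "range (\<lambda>n. compatible S P (F n)) \<subseteq> sets M" using fin(1)[OF F] by auto
  moreover have "decseq (\<lambda>n. compatible S P (F n))"
    by (auto simp: decseq_def compatible_def F_def)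
  ultimately have sets: "compatible S P \<kappa> \<in> sets M" and
    lim: "(\<lambda>n. finite_choice_prob P (F n)) \<longlonglongrightarrow> measure M (compatible S P \<kappa>)"
    using finite_Lim_measure_decseq[of "\<lambda>n. compatible S P (F n)"] fin(2)[OF F]
    by (auto intro!: sets.countable_INT)
  show "compatible S P \<kappa> \<in> sets M" by fact
  have le: "measure M (compatible S P \<kappa>) \<le> finite_choice_prob P G" if "finite G" "G \<subseteq> \<kappa>" for G
    unfolding fin(2)[OF that, symmetric] using that
    by (intro finite_measure_mono fin(1)) (auto simp: compatible_def)
  have "choice_prob P \<kappa> \<le> finite_choice_prob P (F n)" for n
    unfolding choice_prob_def using F le by (intro cINF_lower bdd_belowI2) auto
  then have "choice_prob P \<kappa> \<le> measure M (compatible S P \<kappa>)"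
    using lim by (intro LIMSEQ_le_const) auto
  moreover have "measure M (compatible S P \<kappa>) \<le> choice_prob P \<kappa>"
    unfolding choice_prob_def using le by (intro cINF_greatest) auto
  ultimately show "measure M (compatible S P \<kappa>) = choice_prob P \<kappa>" by simp
qed

lemma (in prob_space) has_sum_measure_UN:
  assumes "countable K" "\<And>k. k \<in> K \<Longrightarrow> X k \<in> sets M" "disjoint_family_on X K"
  shows "((\<lambda>k. measure M (X k)) has_sum measure M (\<Union>k\<in>K. X k)) K"
proof (cases "finite K")
  case True
  then show ?thesis using assms by (subst finite_measure_finite_Union) auto
next
  case False
  have bij: "bij_betw (from_nat_into K) UNIV K"
    using bij_betw_from_nat_into[OF assms(1) False] .
  let ?X = "\<lambda>n. X (from_nat_into K n)"
  have "from_nat_into K n \<in> K" for n using bij by (auto simp: bij_betw_def)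
  then have "range ?X \<subseteq> sets M" using assms(2) by auto
  moreover have "disjoint_family ?X"
    using assms(3) bij unfolding disjoint_family_on_def bij_betw_def inj_on_def by blast
  ultimately have "(\<lambda>n. measure M (?X n)) sums measure M (\<Union>n. ?X n)"
    by (rule finite_measure_UNION)
  moreover have "(\<Union>n. ?X n) = (\<Union>k\<in>K. X k)"
    using bij_betw_imp_surj_on[OF bij] by (metis image_image)
  ultimately have "((\<lambda>n. measure M (?X n)) has_sum measure M (\<Union>k\<in>K. X k)) UNIV"
    by (intro sums_nonneg_imp_has_sum) auto
  then show ?thesis
    using has_sum_reindex_bij_betw[OF bij, of "\<lambda>k. measure M (X k)"] by simp
qed

text \<open>No world contains two incompatible choices, so the sets of compatible worlds are
  disjoint, and explanation plus covering makes their union the set of true worlds. Countably many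
  atomic choices make even infinite explanations measurable.\<close>

lemma covering_has_sum:
  assumes M: "world_measure S P M" and count: "countable (atomic_choices S P)"
    and K: "countable K" "\<forall>\<kappa>\<in>K. explanation S P g \<kappa>" "covering S P g K" "pairwise incompatible K"
  shows "(choice_prob P has_sum measure M (true_worlds S P g)) K"
proof -
  interpret prob_space M using M by (simp add: world_measure_iff)
  have k: "composite_choice S P \<kappa>" "countable \<kappa>" if "\<kappa> \<in> K" for \<kappa>
  proof -
    show "composite_choice S P \<kappa>" using K(2) that by (auto simp: explanation_def)
    then show "countable \<kappa>" using count by (auto simp: composite_choice_def intro: countable_subset)
  qed
  have "compatible S P \<kappa> \<inter> compatible S P \<kappa>' = {}" if "\<kappa> \<in> K" "\<kappa>' \<in> K" "\<kappa> \<noteq> \<kappa>'" for \<kappa> \<kappa>'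
  proof (rule ccontr)
    assume "compatible S P \<kappa> \<inter> compatible S P \<kappa>' \<noteq> {}"
    then obtain w where w: "w \<in> total_choices S P" "\<kappa> \<subseteq> w" "\<kappa>' \<subseteq> w"
      by (auto simp: compatible_def)
    from K(4) that obtain i th b where "(i, th, b) \<in> \<kappa>" "(i, th, \<not> b) \<in> \<kappa>'"
      by (force simp: pairwise_def incompatible_def)
    with w show False using composite_choice_unique[of S P w i th b "\<not> b"]
      by (auto simp: total_choices_def)
  qed
  then have "((\<lambda>\<kappa>. measure M (compatible S P \<kappa>)) has_sum
      measure M (\<Union>\<kappa>\<in>K. compatible S P \<kappa>)) K"
    using K(1) compatible_sets(1)[OF M k] by (intro has_sum_measure_UN) (auto simp: disjoint_family_on_def)
  moreover have "(\<Union>\<kappa>\<in>K. compatible S P \<kappa>) = true_worlds S P g"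
    using K(2,3) by (auto simp: explanation_def covering_def)
  ultimately show ?thesis
    using has_sum_cong[of K "\<lambda>\<kappa>. measure M (compatible S P \<kappa>)" "choice_prob P"]
      compatible_sets(2)[OF M k] by simp
qed

section \<open>Truth of an atom is an event\<close>

lemma body_true_cong:
  "(\<And>l. l \<in> set (body C) \<Longrightarrow> lit_atom l \<in> M \<longleftrightarrow> lit_atom l \<in> N) \<Longrightarrow> body_true M C \<longleftrightarrow> body_true N C"
  unfolding body_true_def
proof (rule ball_cong[OF refl])
  fix l assume "\<And>l. l \<in> set (body C) \<Longrightarrow> lit_atom l \<in> M \<longleftrightarrow> lit_atom l \<in> N" "l \<in> set (body C)"
  then have "lit_atom l \<in> M \<longleftrightarrow> lit_atom l \<in> N" by blast
  then show "lit_true (M, - M) l \<longleftrightarrow> lit_true (N, - N) l" by (cases l) auto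
qed

text \<open>This is closedness in a product of discrete spaces, phrased by finite approximation. The
  condition for a given atom and label inspects \<open>h\<close> at that atom and the body atoms,
  and \<open>A\<close> at the label; a certificate agreeing on this finite window passes the
  condition on.\<close>

lemma certificate_closed:
  fixes cl :: "'l \<Rightarrow> ('f, 'p) clause"
  assumes lim: "\<And>B L. finite B \<Longrightarrow> finite L \<Longrightarrow>
    \<exists>A' h'. certificate A' cl h' \<and> (\<forall>b\<in>B. h' b = h b) \<and> A' \<inter> L = A \<inter> L"
  shows "certificate A cl h"
proof -
  have agree: "\<exists>A' h'. certificate A' cl h' \<and> h' b = h b \<and>
      (\<forall>x\<in>set (body (cl l)). h' (lit_atom x) = h (lit_atom x)) \<and>
      (body_true (dom h') (cl l) \<longleftrightarrow> body_true (dom h) (cl l)) \<and> (l \<in> A' \<longleftrightarrow> l \<in> A)" for b l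
  proof -
    obtain A' h' where h': "certificate A' cl h'"
        "\<forall>c\<in>insert b (lit_atom ` set (body (cl l))). h' c = h c" "A' \<inter> {l} = A \<inter> {l}"
      using lim[of "insert b (lit_atom ` set (body (cl l)))" "{l}"] by auto
    moreover have "body_true (dom h') (cl l) \<longleftrightarrow> body_true (dom h) (cl l)"
      using h'(2) by (intro body_true_cong) (simp add: domIff)
    moreover have "l \<in> A' \<longleftrightarrow> l \<in> A" using h'(3) by blast
    ultimately show ?thesis by auto
  qed
  have "head (cl l) \<in> dom h" if "l \<in> A" "body_true (dom h) (cl l)" for l
  proof -
    from agree[of "head (cl l)" l] that obtain A' h' where
      "certificate A' cl h'" "h' (head (cl l)) = h (head (cl l))" "l \<in> A'" "body_true (dom h') (cl l)"
      by blast
    then have "head (cl l) \<in> dom h'" unfolding certificate_def by blast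
    with \<open>h' (head (cl l)) = h (head (cl l))\<close> show ?thesis by (simp add: domIff)
  qed
  moreover have "l \<in> A \<and> head (cl l) = b \<and> body_true (dom h) (cl l) \<and>
      (\<forall>c. Pos c \<in> set (body (cl l)) \<longrightarrow> (\<exists>m k. h c = Some (m, k) \<and> m < n))"
    if "h b = Some (n, l)" for b n l
  proof -
    from agree[of b l] obtain A' h' where h': "certificate A' cl h'" "h' b = h b"
      "\<forall>x\<in>set (body (cl l)). h' (lit_atom x) = h (lit_atom x)"
      "body_true (dom h') (cl l) \<longleftrightarrow> body_true (dom h) (cl l)" "l \<in> A' \<longleftrightarrow> l \<in> A" by blast
    from h'(2) that have "h' b = Some (n, l)" by simp
    with h'(1) have l: "l \<in> A'" "head (cl l) = b" "body_true (dom h') (cl l)"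
      "\<And>c. Pos c \<in> set (body (cl l)) \<Longrightarrow> \<exists>m k. h' c = Some (m, k) \<and> m < n"
      unfolding certificate_def by blast+
    have "\<exists>m k. h c = Some (m, k) \<and> m < n" if c: "Pos c \<in> set (body (cl l))" for c
      using l(4)[OF c] bspec[OF h'(3) c] by simp
    with l(1-3) h'(4,5) show ?thesis by blast
  qed
  ultimately show ?thesis unfolding certificate_def by blast
qed

text \<open>The first component of a label is the ground clause, the second one is the choice
  that activates it, if any.\<close>

type_synonym ('f, 'p) clabel = "('f, 'p) clause \<times> (nat \<times> (nat \<rightharpoonup> 'f trm)) option"

definition clause_labels :: "('f \<times> nat) set \<Rightarrow> ('f, 'p) plp \<Rightarrow> ('f, 'p) clabel set" where
  "clause_labels S P = {(C, None) | C. C \<in> ground_program S (set (rules P))} \<union>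
     {(Clause (asubst (snd (pfacts P ! i)) (sub_of th)) [], Some (i, th)) | i th.
        (i, th) \<in> choice_points S P}"

text \<open>Activity of a label depends on at most one atomic choice, so on any finite set of labels
  it is determined by finitely many bits of the world.\<close>

definition active_labels :: "('f \<times> nat) set \<Rightarrow> ('f, 'p) plp \<Rightarrow> 'f achoice set \<Rightarrow>
    ('f, 'p) clabel set" where
  "active_labels S P w =
     {(C, c) \<in> clause_labels S P. \<forall>i th. c = Some (i, th) \<longrightarrow> (i, th, True) \<in> w}"

lemma ground_program_Un: "ground_program S (L \<union> L') = ground_program S L \<union> ground_program S L'"
  by (auto simp: ground_program_def)

lemma ground_program_facts:
  assumes "\<And>C. C \<in> L \<Longrightarrow> avars (head C) = {} \<and> body C = []"
  shows "ground_program S L = L"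
proof -
  have C: "csubst C s = C" "cvars C = {}" if "C \<in> L" for C s
    using assms[OF that] by (cases C; simp add: csubst_def asubst_ground cvars_def)+
  show ?thesis
  proof (rule set_eqI)
    fix C
    have "C \<in> ground_program S L \<longleftrightarrow>
        (\<exists>D s. C = csubst D s \<and> D \<in> L \<and> (\<forall>x\<in>cvars D. s x \<in> herbrand_universe S))"
      by (simp add: ground_program_def)
    also have "\<dots> \<longleftrightarrow> C \<in> L" using C by (metis empty_iff)
    finally show "C \<in> ground_program S L \<longleftrightarrow> C \<in> L" .
  qed
qed

lemma clauses_active_labels:
  assumes "w \<in> total_choices S P"
  shows "fst ` active_labels S P w = ground_program S (world_program P w)"
proof -
  let ?F = "{Clause (asubst (snd (pfacts P ! i)) (sub_of th)) [] | i th. (i, th, True) \<in> w}"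
  have "ground_program S ?F = ?F"
    using total_choices_points[OF assms] groundings_ground
    by (intro ground_program_facts) (fastforce simp: choice_points_def)
  then have "ground_program S (world_program P w) = ground_program S (set (rules P)) \<union> ?F"
    by (simp add: world_program_def ground_program_Un)
  also have "\<dots> = fst ` active_labels S P w"
  proof -
    have "active_labels S P w = {(C, None) | C. C \<in> ground_program S (set (rules P))} \<union>
        {(Clause (asubst (snd (pfacts P ! i)) (sub_of th)) [], Some (i, th)) | i th.
          (i, th, True) \<in> w}"
      using total_choices_points[OF assms] by (auto simp: active_labels_def clause_labels_def)
    moreover have "fst ` {(C, None :: (nat \<times> (nat \<rightharpoonup> 'a trm)) option) | C. C \<in> G} = G"
      for G :: "('a, 'b) clause set"
      by force
    moreover have "fst ` {(F i th, Some (i, th)) | i th. (i, th, True) \<in> w} = {F i th | i th. (i, th, True) \<in> w}"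
      for F :: "nat \<Rightarrow> (nat \<rightharpoonup> 'a trm) \<Rightarrow> ('a, 'b) clause"
      by force
    ultimately show ?thesis by (simp only: image_Un)
  qed
  finally show ?thesis ..
qed

lemma clause_labels_base:
  assumes "wf_plp S P" "(C, c) \<in> clause_labels S P"
  shows "head C \<in> herbrand_base S" and "l \<in> set (body C) \<Longrightarrow> lit_atom l \<in> herbrand_base S"
proof -
  have inst: "asubst a s \<in> herbrand_base S"
    if "wf_atom S a" "\<And>x. x \<in> avars a \<Longrightarrow> s x \<in> herbrand_universe S" for a :: "('a, 'b) atom" and s
    using that by (auto simp: herbrand_base_def herbrand_universe_def avars_asubst intro!: wf_asubst)
  have "head C \<in> herbrand_base S \<and> (\<forall>l\<in>set (body C). lit_atom l \<in> herbrand_base S)"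
  proof (cases c)
    case None
    then obtain D s where D: "D \<in> set (rules P)" "C = csubst D s" "\<forall>x\<in>cvars D. s x \<in> herbrand_universe S"
      using assms(2) by (auto simp: clause_labels_def ground_program_def)
    have "wf_clause S D" using assms(1) D(1) by (auto simp: wf_plp_def)
    then show ?thesis using D(2,3)
      by (auto simp: wf_clause_def csubst_def cvars_def lvars_def lit_atom_lsubst intro!: inst)
  next
    case (Some j)
    then obtain i th where i: "i < length (pfacts P)" "th \<in> groundings S (snd (pfacts P ! i))"
        "C = Clause (asubst (snd (pfacts P ! i)) (sub_of th)) []"
      using assms(2) by (auto simp: clause_labels_def choice_points_def)
    have "pfacts P ! i \<in> set (pfacts P)" using i(1) by simp
    then have "wf_atom S (snd (pfacts P ! i))" using assms(1) by (auto simp: wf_plp_def)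
    moreover have "sub_of th x \<in> herbrand_universe S" if "x \<in> avars (snd (pfacts P ! i))" for x
    proof -
      from i(2) that obtain t where "th x = Some t" by (auto simp: groundings_def)
      then show ?thesis using i(2) by (auto simp: groundings_def sub_of_def ran_def)
    qed
    ultimately show ?thesis using i(3) inst by simp
  qed
  then show "head C \<in> herbrand_base S" "l \<in> set (body C) \<Longrightarrow> lit_atom l \<in> herbrand_base S" by auto
qed

lemma countable_choice_points: "countable S \<Longrightarrow> countable (choice_points S P)"
proof -
  assume "countable S"
  then have "countable (SIGMA i:{..<length (pfacts P)}. groundings S (snd (pfacts P ! i)))"
    by (intro countable_SIGMA countable_groundings) auto
  then show ?thesis by (rule countable_subset[rotated]) (auto simp: choice_points_def)
qed

lemma countable_atomic_choices:
  assumes "countable S"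
  shows "countable (atomic_choices S P)"
proof -
  have "atomic_choices S P \<subseteq> (\<lambda>((i, th), k). (i, th, k)) ` (choice_points S P \<times> UNIV)"
    by (force simp: atomic_choices_def choice_points_def)
  then show ?thesis
    by (rule countable_subset) (use countable_choice_points[OF assms] in auto)
qed

lemma countable_clause_labels:
  assumes "countable S"
  shows "countable (clause_labels S P)"
proof -
  have "clause_labels S P \<subseteq> (\<lambda>C. (C, None)) ` ground_program S (set (rules P)) \<union>
      (\<lambda>(i, th). (Clause (asubst (snd (pfacts P ! i)) (sub_of th)) [], Some (i, th))) ` choice_points S P"
    by (auto simp: clause_labels_def)
  then show ?thesis
    by (rule countable_subset)
      (intro countable_Un countable_image countable_ground_program countable_choice_points assms
        countable_finite finite_set)
qed

lemma atom_event:
  fixes S :: "('f \<times> nat) set" and P :: "('f, 'p) plp"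
  assumes S: "countable S" and P: "wf_plp S P"
    and total: "\<forall>w\<in>total_choices S P. two_valued_wfm S (world_program P w)"
    and M: "space M = total_choices S P" "cylinders S P \<subseteq> sets M"
  shows "{w \<in> total_choices S P. a \<in> fst (wf_model S (world_program P w))} \<in> sets M"
proof -
  define T where "T w = fst (wf_model S (world_program P w))" for w
  let ?\<Omega> = "total_choices S P"
  let ?cert = "\<lambda>w h. certificate (active_labels S P w) fst h"
  define J where "J = choice_points S P"
    \<comment> \<open>There may be uncountably many predicate symbols, but only the heads of ground clauses
      can be true.\<close>
  define Hd where "Hd = (\<lambda>l. head (fst l)) ` clause_labels S P"
  have J: "countable J" and Hd: "countable Hd"
    unfolding J_def Hd_def
    using countable_choice_points[OF S] countable_clause_labels[OF S] by auto
  have wfm: "wf_model S (world_program P w) = lfp (wf_op S (fst ` active_labels S P w))"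
    if "w \<in> ?\<Omega>" for w
    using clauses_active_labels[OF that] by (simp add: wf_model_def)
  have sub: "active_labels S P w \<subseteq> clause_labels S P" for w by (auto simp: active_labels_def)
  have ex: "\<exists>h. ?cert w h" if w: "w \<in> ?\<Omega>" for w
  proof (rule certificate_exists)
    show "fst (lfp (wf_op S (fst ` active_labels S P w))) \<union>
        snd (lfp (wf_op S (fst ` active_labels S P w))) = herbrand_base S"
      using bspec[OF total w] unfolding two_valued_wfm_def wfm[OF w] .
    show "lit_atom x \<in> herbrand_base S" if "l \<in> active_labels S P w" "x \<in> set (body (fst l))" for l x
      using clause_labels_base(2)[OF P] sub that by (metis prod.collapse subsetD)
  qed
  have certD: "l \<in> clause_labels S P \<and> b \<in> Hd" if "?cert w h" "h b = Some (n, l)" for w h b n l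
  proof -
    have "l \<in> active_labels S P w" "head (fst l) = b" using that unfolding certificate_def by blast+
    then show ?thesis using subsetD[OF sub] unfolding Hd_def by blast
  qed
  \<comment> \<open>Two-valuedness turns the bounds of \<open>certificate_wf_model\<close> into an
    equality: all certificates of a world share one domain.\<close>
  have dom: "dom h = T w" if w: "w \<in> ?\<Omega>" and h: "?cert w h" for w h
  proof -
    have "fst (wf_model S (world_program P w)) \<subseteq> dom h" "snd (wf_model S (world_program P w)) \<inter> dom h = {}"
      using certificate_wf_model[OF h, where S = S] wfm[OF w] by auto
    moreover have "dom h \<subseteq> herbrand_base S"
    proof
      fix b assume "b \<in> dom h"
      then obtain y where "h b = Some y" by blast
      then have "b \<in> Hd" using certD[OF h, of b "fst y" "snd y"] by simp
      then obtain l where "l \<in> clause_labels S P" "b = head (fst l)" unfolding Hd_def by blast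
      then show "b \<in> herbrand_base S" using clause_labels_base(1)[OF P] by (metis prod.collapse)
    qed
    ultimately show ?thesis using total w unfolding two_valued_wfm_def T_def by blast
  qed
  \<comment> \<open>Coordinate \<open>k\<close> holds both the bit of the \<open>k\<close>-th choice
    point and the certificate value at the \<open>k\<close>-th head, so one sequence codes the pair.
    Entries beyond the end of a finite enumeration are arbitrary and never read back.\<close>
  define u where "u k = (\<lambda>(w, h :: ('f, 'p) atom \<rightharpoonup> nat \<times> ('f, 'p) clabel).
      ((fst (from_nat_into J k), snd (from_nat_into J k), True) \<in> w, h (from_nat_into Hd k)))" for k
  define W where "W x = world_of S P (\<lambda>j. fst (x (to_nat_on J j)))"
    for x :: "nat \<Rightarrow> bool \<times> (nat \<times> ('f, 'p) clabel) option"
  \<comment> \<open>The default \<open>None\<close> is the right value off \<open>Hd\<close>: by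
    \<open>certD\<close>, a certificate is defined only at heads of labelled clauses.\<close>
  define H where "H x b = (if b \<in> Hd then snd (x (to_nat_on Hd b)) else None)"
    for x :: "nat \<Rightarrow> bool \<times> (nat \<times> ('f, 'p) clabel) option" and b
  have W_total: "W x \<in> ?\<Omega>" for x unfolding W_def by (rule world_of_total)
  have agree_W: "(i, th, True) \<in> w \<longleftrightarrow> (i, th, True) \<in> W x"
    if "\<forall>k<n. u k (w, h) = x k" "(i, th) \<in> J" "to_nat_on J (i, th) < n" for w h n x i th
    using that(1)[rule_format, OF that(3)] that(2) from_nat_into_to_nat_on[OF J that(2)]
    by (auto simp: u_def W_def world_of_def J_def[symmetric] prod_eq_iff)
  have agree_H: "h b = H x b"
    if "?cert w h" "\<forall>k<n. u k (w, h) = x k" "b \<in> Hd \<longrightarrow> to_nat_on Hd b < n" for w h n x b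
  proof (cases "b \<in> Hd")
    case True
    then show ?thesis using that(2)[rule_format, of "to_nat_on Hd b"] that(3) from_nat_into_to_nat_on[OF Hd True]
      by (auto simp: u_def H_def prod_eq_iff)
  next
    case False
    then show ?thesis using certD[OF that(1)] by (cases "h b") (auto simp: H_def)
  qed
  have lim: "?cert (W x) (H x)"
    if x: "\<And>n. \<exists>w h. w \<in> ?\<Omega> \<and> ?cert w h \<and> (\<forall>k<n. u k (w, h) = x k)" for x
  proof (rule certificate_closed)
    fix B :: "('f, 'p) atom set" and L :: "('f, 'p) clabel set"
    assume "finite B" "finite L"
    \<comment> \<open>These are the choice points on which the activity of labels in
      \<open>L\<close> depends; \<open>n\<close> is then taken beyond their codes and those of
      \<open>B\<close>.\<close>
    define D where "D = {j \<in> J. Some j \<in> snd ` L}"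
    have "D \<subseteq> the ` snd ` L" by (force simp: D_def)
    then have "finite D" using \<open>finite L\<close> by (auto intro: finite_subset)
    then have "finite (to_nat_on Hd ` B \<union> to_nat_on J ` D)" using \<open>finite B\<close> by simp
    then obtain n where n: "\<And>k. k \<in> to_nat_on Hd ` B \<union> to_nat_on J ` D \<Longrightarrow> k < n"
      unfolding finite_nat_set_iff_bounded by blast
    from x[of n] obtain w h where w: "w \<in> ?\<Omega>" "?cert w h" "\<forall>k<n. u k (w, h) = x k" by blast
    have "\<forall>b\<in>B. h b = H x b" using agree_H[OF w(2,3)] n by auto
    moreover have "active_labels S P w \<inter> L = active_labels S P (W x) \<inter> L"
    proof -
      have "(C, c) \<in> active_labels S P w \<longleftrightarrow> (C, c) \<in> active_labels S P (W x)"
        if "(C, c) \<in> L" for C c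
      proof (cases "(C, c) \<in> clause_labels S P \<and> c \<noteq> None")
        case True
        then obtain i th where c: "c = Some (i, th)" "(i, th) \<in> J"
          by (auto simp: clause_labels_def J_def)
        then have "(i, th) \<in> D" using that by (force simp: D_def)
        then have "(i, th, True) \<in> w \<longleftrightarrow> (i, th, True) \<in> W x"
          using agree_W[OF w(3) c(2)] n by blast
        then show ?thesis by (simp add: active_labels_def c(1))
      qed (auto simp: active_labels_def)
      then show ?thesis by auto
    qed
    ultimately show "\<exists>A' h'. certificate A' fst h' \<and> (\<forall>b\<in>B. h' b = H x b) \<and>
        A' \<inter> L = active_labels S P (W x) \<inter> L" using w(2) by blast
  qed
  let ?X = "{(w, h). w \<in> ?\<Omega> \<and> ?cert w h \<and> a \<in> dom h}"
  let ?Y = "{(w, h). w \<in> ?\<Omega> \<and> ?cert w h \<and> a \<notin> dom h}"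
  have "separable M (fst ` ?X) (fst ` ?Y)"
  proof (rule ccontr)
    assume insep: "\<not> separable M (fst ` ?X) (fst ` ?Y)"
    let ?V = "(UNIV :: bool set) \<times> insert None (Some ` ((UNIV :: nat set) \<times> clause_labels S P))"
    have V: "countable ?V"
      by (intro countable_SIGMA countable_insert countable_image countable_clause_labels[OF S]) auto
    have uV: "u k z \<in> ?V" if zXY: "z \<in> ?X \<union> ?Y" for k z
    proof -
      obtain w h where z: "z = (w, h)" "?cert w h" using zXY by auto
      then show ?thesis using certD[OF z(2)]
        by (cases "h (from_nat_into Hd k)") (auto simp: u_def)
    qed
    have sp: "fst ` ?X \<subseteq> space M" by (auto simp: M)
    obtain x y where xy: "\<And>n. \<not> separable M (fst ` {z \<in> ?X. \<forall>k<n. u k z = x k})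
        (fst ` {z \<in> ?Y. \<forall>k<n. u k z = y k})"
      using Lusin_refinement[where u = u, OF V uV sp insep] by blast
    have X: "\<exists>w h. w \<in> ?\<Omega> \<and> ?cert w h \<and> a \<in> dom h \<and> (\<forall>k<n. u k (w, h) = x k)" for n
    proof -
      have "{z \<in> ?X. \<forall>k<n. u k z = x k} \<noteq> {}"
        using inseparable_nonempty(1)[OF xy[of n]] by simp
      then show ?thesis by auto
    qed
    have Y: "\<exists>w h. w \<in> ?\<Omega> \<and> ?cert w h \<and> a \<notin> dom h \<and> (\<forall>k<n. u k (w, h) = y k)" for n
    proof -
      have "fst ` {z \<in> ?X. \<forall>k<n. u k z = x k} \<subseteq> space M" using sp by blast
      then have "{z \<in> ?Y. \<forall>k<n. u k z = y k} \<noteq> {}"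
        using inseparable_nonempty(2)[OF xy[of n]] by simp
      then show ?thesis by auto
    qed
    have cx: "?cert (W x) (H x)" by (rule lim) (use X in blast)
    have cy: "?cert (W y) (H y)" by (rule lim) (use Y in blast)
    \<comment> \<open>\<open>Suc\<close> puts the coordinate of \<open>a\<close> among the fixed
      ones, so the limit inherits the status of \<open>a\<close>.\<close>
    have "a \<in> dom (H x)"
    proof -
      obtain w h where "?cert w h" "a \<in> dom h" "\<forall>k<Suc (to_nat_on Hd a). u k (w, h) = x k"
        using X by blast
      then show ?thesis using agree_H[of w h "Suc (to_nat_on Hd a)" x a] by (simp add: domIff)
    qed
    moreover have "a \<notin> dom (H y)"
    proof -
      obtain w h where "?cert w h" "a \<notin> dom h" "\<forall>k<Suc (to_nat_on Hd a). u k (w, h) = y k"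
        using Y by blast
      then show ?thesis using agree_H[of w h "Suc (to_nat_on Hd a)" y a] by (simp add: domIff)
    qed
    \<comment> \<open>Equal worlds would have certificates with equal domains. Once the bit at which
      the limit worlds differ is fixed, the cylinder of that choice contains one piece and misses
      the other.\<close>
    ultimately have "W x \<noteq> W y" using dom[OF W_total cx] dom[OF W_total cy] by auto
    then obtain i th where j: "(i, th) \<in> J" "(i, th, True) \<in> W x \<longleftrightarrow> (i, th, True) \<notin> W y"
      using total_choices_eqI[OF W_total W_total] unfolding J_def by blast
    define b where b: "b \<longleftrightarrow> (i, th, True) \<in> W x"
    let ?n = "Suc (to_nat_on J (i, th))" and ?C = "compatible S P {(i, th, b)}"
    have C: "w \<in> ?C \<longleftrightarrow> w \<in> ?\<Omega> \<and> ((i, th, True) \<in> w \<longleftrightarrow> b)" for w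
      using total_choicesD[of w S P i th b] j(1) by (auto simp: compatible_def J_def)
    have "(i, th, b) \<in> atomic_choices S P"
      using j(1) by (auto simp: J_def choice_points_def atomic_choices_def)
    then have "?C \<in> sets M" using M(2) by (auto simp: cylinders_def composite_choice_def)
    moreover have x_C: "(i, th, True) \<in> w \<longleftrightarrow> b" if "\<forall>k<?n. u k (w, h) = x k" for w h
      using agree_W[OF that j(1)] b by simp
    then have "fst ` {z \<in> ?X. \<forall>k<?n. u k z = x k} \<subseteq> ?C" by (auto simp: C)
    moreover have y_C: "(i, th, True) \<in> w \<longleftrightarrow> \<not> b" if "\<forall>k<?n. u k (w, h) = y k" for w h
      using agree_W[OF that j(1)] b j(2) by simp
    then have "fst ` {z \<in> ?Y. \<forall>k<?n. u k z = y k} \<inter> ?C = {}" by (auto simp: C)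
    ultimately show False using xy[of ?n] unfolding separable_def by blast
  qed
  then obtain B where B: "B \<in> sets M" "fst ` ?X \<subseteq> B" "fst ` ?Y \<inter> B = {}"
    unfolding separable_def by blast
  have ex_cert: "(\<exists>h. ?cert w h \<and> Q (dom h)) \<longleftrightarrow> Q (T w)" if w: "w \<in> ?\<Omega>" for w Q
  proof
    assume "\<exists>h. ?cert w h \<and> Q (dom h)"
    then obtain h where "?cert w h" "Q (dom h)" by blast
    then show "Q (T w)" using dom[OF w] by simp
  next
    assume "Q (T w)"
    moreover obtain h where "?cert w h" using ex[OF w] by blast
    ultimately have "?cert w h \<and> Q (dom h)" using dom[OF w] by simp
    then show "\<exists>h. ?cert w h \<and> Q (dom h)" by blast
  qed
  have X: "fst ` ?X = {w \<in> ?\<Omega>. a \<in> T w}"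
  proof (rule set_eqI)
    fix w
    have "w \<in> fst ` ?X \<longleftrightarrow> w \<in> ?\<Omega> \<and> (\<exists>h. ?cert w h \<and> a \<in> dom h)"
      by (simp add: image_iff) blast
    then show "w \<in> fst ` ?X \<longleftrightarrow> w \<in> {w \<in> ?\<Omega>. a \<in> T w}"
      using ex_cert[of w "\<lambda>D. a \<in> D"] by blast
  qed
  have Y: "fst ` ?Y = {w \<in> ?\<Omega>. a \<notin> T w}"
  proof (rule set_eqI)
    fix w
    have "w \<in> fst ` ?Y \<longleftrightarrow> w \<in> ?\<Omega> \<and> (\<exists>h. ?cert w h \<and> a \<notin> dom h)"
      by (simp add: image_iff) blast
    then show "w \<in> fst ` ?Y \<longleftrightarrow> w \<in> {w \<in> ?\<Omega>. a \<notin> T w}"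
      using ex_cert[of w "\<lambda>D. a \<notin> D"] by blast
  qed
  have "B \<subseteq> ?\<Omega>" using sets.sets_into_space[OF B(1)] by (simp add: M(1))
  then have "{w \<in> ?\<Omega>. a \<in> T w} = B" using B(2,3) unfolding X Y by blast
  then show ?thesis using B(1) by (simp add: T_def)
qed

lemma well_defined_probI:
  assumes S: "countable S" and P: "wf_plp S P"
    and total: "\<forall>w\<in>total_choices S P. two_valued_wfm S (world_program P w)"
  shows "well_defined_prob S P g"
proof -
  have "\<exists>!M. world_measure S P M"
    using world_measure_exists[OF P] world_measure_unique by blast
  moreover have "true_worlds S P g \<in> sets M" if M: "world_measure S P M" for M
  proof -
    have sp: "space M = total_choices S P" and cy: "cylinders S P \<subseteq> sets M"
      using M by (auto simp: world_measure_iff)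
    have "{w \<in> space M. \<forall>a\<in>set g. a \<in> fst (wf_model S (world_program P w))} \<in> sets M"
      using atom_event[OF S P total sp cy] by (intro sets.sets_Collect_finite_All) (auto simp: sp)
    then show ?thesis by (simp add: true_worlds_def sp subset_eq)
  qed
  moreover have "(choice_prob P has_sum measure M (true_worlds S P g)) K"
    if "world_measure S P M" "countable K \<and> (\<forall>\<kappa>\<in>K. explanation S P g \<kappa>) \<and> covering S P g K \<and>
      pairwise incompatible K" for M K
    using that covering_has_sum[OF that(1) countable_atomic_choices[OF S]] by blast
  ultimately show ?thesis unfolding well_defined_prob_def by blast
qed

theorem theorem1:
  fixes S :: "('f \<times> nat) set"
    and P :: "('f, 'p) plp"
    and q :: "('f, 'p) atom list"
  assumes "countable S"
    and "wf_plp S P"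
    and "\<forall>a\<in>set q. wf_atom S a"
    and "\<forall>w\<in>total_choices S P. two_valued_wfm S (world_program P w)"
    and "range_restricted P"
    and "pfact_calls_bound P"
  shows "\<forall>r. answer S P q r \<longrightarrow> ground_instance q r \<and> well_defined_prob S P r"
  using answer_ground_instance[OF assms(5)] well_defined_probI[OF assms(1,2,4)] by blast

end
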